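(* Let $R$ be a Dedekind domain with field of fractions $K$. Let $a,b,c\in R\setminus\{0\}$ and $n\in\mathbb{N}$ be such that there is a nonzero prime ideal $\mathfrak{p}\subseteq R$ with $a,b,a+b,c\notin\mathfrak{p}$ and $[R:\mathfrak{p}]<\infty$ for which none of $\frac{a}{c},\frac{b}{c},\frac{a+b}{c}$ is an $n$th power in $R/\mathfrak{p}$. Let $K_{\mathfrak{p}}$ denote the completion of $K$ at $\mathfrak{p}$. Then the equation $ax+by=cwz^n$ is not partition regular over $K_{\mathfrak{p}}\setminus\{0\}$.
   Context: For $u\in R$ and $v\in R\setminus\mathfrak{p}$, the residue of $\frac{u}{v}$ modulo $\mathfrak{p}$ is $uv^{-1}$ in the field $R/\mathfrak{p}$. $[R:\mathfrak{p}]$ is the index of $\mathfrak{p}$ in $(R,+)$. An equation in $w,x,y,z$ is partition regular over a set $S$ if for every finite partition of $S$ some cell contains (not necessarily distinct) $w,x,y,z$ satisfying it. *)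

theory Defs
  imports "HOL-Algebra.Algebra" "HOL-Library.Disjoint_Sets"
begin

text \<open>
  The field of fractions is given up to isomorphism: \<open>\<iota>\<close> embeds the domain \<open>R\<close> into
  the field \<open>K\<close>, and every element of \<open>K\<close> is a quotient of images.
\<close>

locale fraction_field =
  R: domain R + K: field K
  for R :: "('a, 'm) ring_scheme" and K :: "('k, 'n) ring_scheme" and \<iota> :: "'a \<Rightarrow> 'k" +
  assumes embed_hom: "\<iota> \<in> ring_hom R K"
    and embed_inj: "inj_on \<iota> (carrier R)"
    and embed_quotients: "x \<in> carrier K \<Longrightarrow>
      \<exists>u\<in>carrier R. \<exists>v\<in>carrier R - {\<zero>\<^bsub>R\<^esub>}. x = \<iota> u \<otimes>\<^bsub>K\<^esub> inv\<^bsub>K\<^esub> (\<iota> v)"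

text \<open>
  Polynomials over a ring are coefficient lists with the leading coefficient first; the
  zero polynomial \<open>[]\<close> has no leading coefficient and must be excluded when saying ``monic''.
\<close>

definition integrally_closed_in :: "('k, 'n) ring_scheme \<Rightarrow> 'k set \<Rightarrow> bool" where
  "integrally_closed_in K A \<longleftrightarrow>
     (\<forall>x\<in>carrier K.
        (\<exists>f. f \<in> carrier (univ_poly K A) \<and> f \<noteq> [] \<and> lead_coeff f = \<one>\<^bsub>K\<^esub>
             \<and> ring.eval K f x = \<zero>\<^bsub>K\<^esub>) \<longrightarrow> x \<in> A)"

locale dedekind_domain =
  fraction_field R K \<iota> + noetherian_domain R
  for R :: "('a, 'm) ring_scheme" and K :: "('k, 'n) ring_scheme" and \<iota> :: "'a \<Rightarrow> 'k" +
  assumes integrally_closed: "integrally_closed_in K (\<iota> ` carrier R)"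
    and nonzero_prime_maximal: "primeideal q R \<Longrightarrow> q \<noteq> {\<zero>\<^bsub>R\<^esub>} \<Longrightarrow> maximalideal q R"

text \<open>The residue of \<open>u / v\<close> modulo \<open>\<pp>\<close>, meaningful when \<open>v \<notin> \<pp>\<close>.\<close>

definition residue_frac :: "('a, 'm) ring_scheme \<Rightarrow> 'a set \<Rightarrow> 'a \<Rightarrow> 'a \<Rightarrow> 'a set" where
  "residue_frac R \<pp> u v =
     (\<pp> +>\<^bsub>R\<^esub> u) \<otimes>\<^bsub>R Quot \<pp>\<^esub> inv\<^bsub>R Quot \<pp>\<^esub> (\<pp> +>\<^bsub>R\<^esub> v)"

definition is_nth_power :: "('a, 'm) ring_scheme \<Rightarrow> nat \<Rightarrow> 'a \<Rightarrow> bool" where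
  "is_nth_power F n x \<longleftrightarrow> (\<exists>t\<in>carrier F. x = t [^]\<^bsub>F\<^esub> n)"

text \<open>
  The \<open>\<pp>\<close>-adic valuation of a nonzero \<open>x\<close> in \<open>R\<close> is the largest \<open>n\<close> with \<open>x \<in> \<pp>\<^sup>n\<close>;
  it extends to nonzero elements of \<open>K\<close> by \<open>v(u / w) = v(u) - v(w)\<close>. The
  values at zero are irrelevant: \<open>adic_close\<close> treats a zero difference separately.
\<close>

definition ideal_ord :: "('a, 'm) ring_scheme \<Rightarrow> 'a set \<Rightarrow> 'a \<Rightarrow> nat" where
  "ideal_ord R \<pp> x = (GREATEST n. x \<in> \<pp> [^]\<^bsub>ideals_set R\<^esub> n)"

definition adic_val ::
    "('a, 'm) ring_scheme \<Rightarrow> ('k, 'n) ring_scheme \<Rightarrow> ('a \<Rightarrow> 'k) \<Rightarrow> 'a set \<Rightarrow> 'k \<Rightarrow> int" where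
  "adic_val R K \<iota> \<pp> x =
     (THE k. \<exists>u\<in>carrier R - {\<zero>\<^bsub>R\<^esub>}. \<exists>w\<in>carrier R - {\<zero>\<^bsub>R\<^esub>}.
        x = \<iota> u \<otimes>\<^bsub>K\<^esub> inv\<^bsub>K\<^esub> (\<iota> w) \<and> k = int (ideal_ord R \<pp> u) - int (ideal_ord R \<pp> w))"

definition adic_close ::
    "('a, 'm) ring_scheme \<Rightarrow> ('k, 'n) ring_scheme \<Rightarrow> ('a \<Rightarrow> 'k) \<Rightarrow> 'a set \<Rightarrow> int \<Rightarrow> 'k \<Rightarrow> 'k \<Rightarrow> bool" where
  "adic_close R K \<iota> \<pp> N x y \<longleftrightarrow> x = y \<or> N \<le> adic_val R K \<iota> \<pp> (x \<ominus>\<^bsub>K\<^esub> y)"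

text \<open>
  The completion of \<open>K\<close> at \<open>\<pp>\<close>: the ring of \<open>\<pp>\<close>-adic Cauchy sequences in \<open>K\<close>, with
  pointwise operations, modulo the ideal of sequences converging to zero.
\<close>

definition adic_Cauchy_ring ::
    "('a, 'm) ring_scheme \<Rightarrow> ('k, 'n) ring_scheme \<Rightarrow> ('a \<Rightarrow> 'k) \<Rightarrow> 'a set \<Rightarrow> (nat \<Rightarrow> 'k) ring" where
  "adic_Cauchy_ring R K \<iota> \<pp> =
     \<lparr>carrier = {s. range s \<subseteq> carrier K \<and>
                    (\<forall>N. \<exists>M. \<forall>i\<ge>M. \<forall>j\<ge>M. adic_close R K \<iota> \<pp> N (s i) (s j))},
      monoid.mult = (\<lambda>s t i. s i \<otimes>\<^bsub>K\<^esub> t i),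
      monoid.one = (\<lambda>i. \<one>\<^bsub>K\<^esub>),
      ring.zero = (\<lambda>i. \<zero>\<^bsub>K\<^esub>),
      ring.add = (\<lambda>s t i. s i \<oplus>\<^bsub>K\<^esub> t i)\<rparr>"

definition adic_null ::
    "('a, 'm) ring_scheme \<Rightarrow> ('k, 'n) ring_scheme \<Rightarrow> ('a \<Rightarrow> 'k) \<Rightarrow> 'a set \<Rightarrow> (nat \<Rightarrow> 'k) set" where
  "adic_null R K \<iota> \<pp> =
     {s \<in> carrier (adic_Cauchy_ring R K \<iota> \<pp>).
        \<forall>N. \<exists>M. \<forall>i\<ge>M. adic_close R K \<iota> \<pp> N (s i) \<zero>\<^bsub>K\<^esub>}"

definition adic_completion ::
    "('a, 'm) ring_scheme \<Rightarrow> ('k, 'n) ring_scheme \<Rightarrow> ('a \<Rightarrow> 'k) \<Rightarrow> 'a set \<Rightarrow> (nat \<Rightarrow> 'k) set ring" where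
  "adic_completion R K \<iota> \<pp> = adic_Cauchy_ring R K \<iota> \<pp> Quot adic_null R K \<iota> \<pp>"

definition to_completion ::
    "('a, 'm) ring_scheme \<Rightarrow> ('k, 'n) ring_scheme \<Rightarrow> ('a \<Rightarrow> 'k) \<Rightarrow> 'a set \<Rightarrow> 'a \<Rightarrow> (nat \<Rightarrow> 'k) set" where
  "to_completion R K \<iota> \<pp> r = adic_null R K \<iota> \<pp> +>\<^bsub>adic_Cauchy_ring R K \<iota> \<pp>\<^esub> (\<lambda>_. \<iota> r)"

definition partition_regular_over :: "'s set \<Rightarrow> ('s \<Rightarrow> 's \<Rightarrow> 's \<Rightarrow> 's \<Rightarrow> bool) \<Rightarrow> bool" where
  "partition_regular_over S E \<longleftrightarrow>
     (\<forall>P. finite P \<and> partition_on S P \<longrightarrow>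
        (\<exists>C\<in>P. \<exists>w\<in>C. \<exists>x\<in>C. \<exists>y\<in>C. \<exists>z\<in>C. E w x y z))"

end

theory Submission
  imports Defs
begin

text \<open>
  The nonzero elements \<open>x\<close> of the completion are coloured by their leading coefficient \<open>ac x\<close>, the
  residue of \<open>x / \<pi> ^ v x\<close> for a uniformizer \<open>\<pi>\<close>; the residue field being finite, there are finitely
  many colours. Suppose \<open>a x + b y = c w z ^ n\<close>, where all four variables have leading coefficient
  \<open>s\<close>. The right-hand side has leading coefficient \<open>c s s ^ n\<close>. The left-hand side has leading
  coefficient \<open>a s\<close>, \<open>b s\<close> or \<open>(a + b) s\<close>, according to whether \<open>v x < v y\<close>, \<open>v x > v y\<close> or
  \<open>v x = v y\<close>; there is no cancellation, as \<open>a\<close>, \<open>b\<close> and \<open>a + b\<close> are units modulo \<open>\<pp>\<close>. Cancelling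
  \<open>s\<close> shows that one of \<open>a / c\<close>, \<open>b / c\<close> and \<open>(a + b) / c\<close> is an \<open>n\<close>th power in the residue field,
  contrary to the hypothesis. This is \<open>ac_equation_imp_power\<close>, and
  \<open>completion_not_partition_regular\<close> carries it over from \<open>K\<close> to Cauchy sequences, whose leading
  terms are eventually constant unless the sequence is null.

  What remains is to provide \<open>ac\<close> on \<open>K\<close>, and this is where \<open>R\<close> being a Dedekind domain
  enters. The localization of \<open>R\<close> at \<open>\<pp>\<close> has to be a discrete valuation ring. This is shown inside
  \<open>R\<close>, without localizing: \<open>uniformizer_exists\<close> finds \<open>\<pi>\<close> in \<open>\<pp>\<close> and \<open>s\<close> outside \<open>\<pp>\<close>
  such that \<open>\<pi>\<close> divides \<open>s x\<close> for all \<open>x\<close> in \<open>\<pp>\<close>, and \<open>uniformizer_factorization\<close> concludes that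
  every nonzero element is, up to factors outside \<open>\<pp>\<close>, a power of \<open>\<pi>\<close>. Leading terms are read off
  from such factorizations, and \<open>adic_val_eq\<close> identifies the exponent of \<open>\<pi>\<close> with the valuation
  defined by the powers of the ideal \<open>\<pp>\<close>.
\<close>

section \<open>Partition regularity and colourings\<close>

lemma partition_regular_over_coloring:
  assumes "partition_regular_over S E" and "finite (f ` S)"
  obtains w x y z where "w \<in> S" "x \<in> S" "y \<in> S" "z \<in> S"
    and "f x = f w" "f y = f w" "f z = f w" and "E w x y z"
proof -
  define P where "P = (\<lambda>q. {x\<in>S. f x = q}) ` (f ` S)"
  have "partition_on S P"
    by (rule partition_onI) (auto simp: P_def disjnt_def)
  moreover have "finite P"
    using assms(2) by (simp add: P_def)
  ultimately obtain C w x y z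
    where "C \<in> P" "w \<in> C" "x \<in> C" "y \<in> C" "z \<in> C" "E w x y z"
    using assms(1) unfolding partition_regular_over_def by meson
  moreover from \<open>C \<in> P\<close> obtain q where "C = {x\<in>S. f x = q}"
    by (auto simp: P_def)
  ultimately show thesis
    using that[of w x y z] by simp
qed

section \<open>Fields with an angular component\<close>

text \<open>
  The data of a \<open>\<pp>\<close>-adic field that the argument uses: the valuation \<open>v\<close> and the
  residue \<open>ac x\<close> of \<open>x / \<varpi> ^ v x\<close>, for a fixed uniformizer \<open>\<varpi>\<close>. The axioms on sums
  leave out those with cancellation; of these only the ultrametric inequality is needed, and it
  follows (\<open>val_ball_add\<close>).
\<close>

locale angular_component =
  K: field K + F: field F
  for K :: "('k, 'n) ring_scheme" (structure) and F :: "('f, 'q) ring_scheme" +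
  fixes v :: "'k \<Rightarrow> int" and ac :: "'k \<Rightarrow> 'f"
  assumes ac_closed: "x \<in> carrier K - {\<zero>} \<Longrightarrow> ac x \<in> carrier F - {\<zero>\<^bsub>F\<^esub>}"
    and v_mult: "x \<in> carrier K - {\<zero>} \<Longrightarrow> y \<in> carrier K - {\<zero>} \<Longrightarrow> v (x \<otimes> y) = v x + v y"
    and ac_mult: "x \<in> carrier K - {\<zero>} \<Longrightarrow> y \<in> carrier K - {\<zero>} \<Longrightarrow> ac (x \<otimes> y) = ac x \<otimes>\<^bsub>F\<^esub> ac y"
    and v_add_less: "x \<in> carrier K - {\<zero>} \<Longrightarrow> y \<in> carrier K - {\<zero>} \<Longrightarrow> v x < v y \<Longrightarrow>
      v (x \<oplus> y) = v x"
    and ac_add_less: "x \<in> carrier K - {\<zero>} \<Longrightarrow> y \<in> carrier K - {\<zero>} \<Longrightarrow> v x < v y \<Longrightarrow>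
      ac (x \<oplus> y) = ac x"
    and ac_add_eq: "x \<in> carrier K - {\<zero>} \<Longrightarrow> y \<in> carrier K - {\<zero>} \<Longrightarrow> v x = v y \<Longrightarrow>
      ac x \<oplus>\<^bsub>F\<^esub> ac y \<noteq> \<zero>\<^bsub>F\<^esub> \<Longrightarrow> ac (x \<oplus> y) = ac x \<oplus>\<^bsub>F\<^esub> ac y"
begin

lemma mult_nonzero: "x \<in> carrier K - {\<zero>} \<Longrightarrow> y \<in> carrier K - {\<zero>} \<Longrightarrow> x \<otimes> y \<in> carrier K - {\<zero>}"
  using K.integral by auto

lemma pow_nonzero: "x \<in> carrier K - {\<zero>} \<Longrightarrow> x [^] (n::nat) \<in> carrier K - {\<zero>}"
  by (induction n) (use mult_nonzero in auto)

lemma v_one: "v \<one> = 0"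
  using v_mult[of \<one> \<one>] by simp

text \<open>
  The integer \<open>v (- 1)\<close> vanishes because twice it is \<open>v 1 = 0\<close>.
\<close>

lemma v_minus:
  assumes "x \<in> carrier K - {\<zero>}"
  shows "v (\<ominus> x) = v x"
proof -
  have n1: "\<ominus> \<one> \<in> carrier K - {\<zero>}"
    by (simp add: K.add.inv_eq_1_iff)
  have "v (\<ominus> \<one>) + v (\<ominus> \<one>) = v (\<ominus> \<one> \<otimes> \<ominus> \<one>)"
    using v_mult[OF n1 n1] by simp
  also have "\<dots> = 0"
    using v_one by (simp add: K.l_minus)
  finally have "v (\<ominus> \<one>) = 0"
    by simp
  then show ?thesis
    using v_mult[OF n1 assms] assms by (simp add: K.l_minus)
qed

definition val_ball :: "int \<Rightarrow> 'k set" where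
  "val_ball N = {x \<in> carrier K. x = \<zero> \<or> N \<le> v x}"

lemma val_ball_carrier: "x \<in> val_ball N \<Longrightarrow> x \<in> carrier K"
  by (simp add: val_ball_def)

lemma val_ball_zero [simp]: "\<zero> \<in> val_ball N"
  by (simp add: val_ball_def)

lemma val_ball_mono: "x \<in> val_ball N \<Longrightarrow> M \<le> N \<Longrightarrow> x \<in> val_ball M"
  by (auto simp: val_ball_def)

lemma val_ball_minus [simp]: "x \<in> val_ball N \<Longrightarrow> \<ominus> x \<in> val_ball N"
  using v_minus[of x] by (cases "x = \<zero>") (auto simp: val_ball_def)

text \<open>
  The ultrametric inequality is a consequence of \<open>v_add_less\<close>: if \<open>z = x + y\<close> had a smaller
  valuation than \<open>x\<close> and \<open>y\<close>, then \<open>x = z + (- y)\<close> would have the valuation of \<open>z\<close>.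
\<close>

lemma val_ball_add [simp]:
  assumes "x \<in> val_ball N" "y \<in> val_ball N"
  shows "x \<oplus> y \<in> val_ball N"
proof (cases "x = \<zero> \<or> y = \<zero> \<or> x \<oplus> y = \<zero>")
  case True
  then show ?thesis
    using assms by (auto simp: val_ball_carrier)
next
  case False
  have x: "x \<in> carrier K - {\<zero>}" and y: "y \<in> carrier K - {\<zero>}"
    and xy: "x \<oplus> y \<in> carrier K - {\<zero>}" and my: "\<ominus> y \<in> carrier K - {\<zero>}"
    using assms[THEN val_ball_carrier] False by (simp_all add: K.add.inv_eq_1_iff)
  have "x = (x \<oplus> y) \<oplus> \<ominus> y"
    using x y by (simp add: K.a_assoc K.r_neg)
  then have "\<not> (v (x \<oplus> y) < N)"
    using v_add_less[OF xy my] v_minus[OF y] assms False by (auto simp: val_ball_def)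
  then show ?thesis
    using xy by (simp add: val_ball_def)
qed

lemma val_ball_mult:
  assumes "x \<in> val_ball N" "y \<in> val_ball M"
  shows "x \<otimes> y \<in> val_ball (N + M)"
  using assms v_mult[of x y] by (cases "x = \<zero> \<or> y = \<zero>") (auto simp: val_ball_def)

lemma val_ball_v: "x \<in> carrier K \<Longrightarrow> x \<in> val_ball (v x)"
  by (simp add: val_ball_def)

text \<open>
  Leading terms are locally constant away from zero; this is what lets them pass to the limit of
  a Cauchy sequence.
\<close>

lemma ac_perturb:
  assumes "x \<in> carrier K - {\<zero>}" "y \<in> carrier K" "y \<ominus> x \<in> val_ball (v x + 1)"
  shows "y \<noteq> \<zero>" "v y = v x" "ac y = ac x"
proof -
  have *: "y = x \<oplus> (y \<ominus> x)"
    using assms(1,2) by (simp add: a_minus_def K.a_comm[of y] K.r_neg2)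
  have "v y = v x \<and> ac y = ac x"
  proof (cases "y \<ominus> x = \<zero>")
    case True
    then show ?thesis
      using * assms(1) by simp
  next
    case False
    then have "v x < v (y \<ominus> x)" "y \<ominus> x \<in> carrier K - {\<zero>}"
      using assms(3) by (auto simp: val_ball_def)
    then show ?thesis
      using v_add_less[OF assms(1)] ac_add_less[OF assms(1)] * by metis
  qed
  then show "v y = v x" "ac y = ac x"
    by auto
  show "y \<noteq> \<zero>"
  proof
    assume "y = \<zero>"
    then have "\<ominus> x \<in> val_ball (v x + 1)"
      using assms by (simp add: a_minus_def)
    from val_ball_minus[OF this] show False
      using assms(1) by (simp add: val_ball_def)
  qed
qed

lemma ac_pow:
  assumes "x \<in> carrier K - {\<zero>}"
  shows "ac (x [^] (n::nat)) = ac x [^]\<^bsub>F\<^esub> n"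
proof (induction n)
  case 0
  have "ac \<one> \<otimes>\<^bsub>F\<^esub> ac \<one> = ac \<one>"
    using ac_mult[of \<one> \<one>] by simp
  then show ?case
    using ac_closed[of \<one>] F.m_rcancel[of "ac \<one>" "ac \<one>" "\<one>\<^bsub>F\<^esub>"] by simp
next
  case (Suc n)
  then show ?case
    using ac_mult[OF pow_nonzero[OF assms] assms] by simp
qed

lemma v_pow:
  assumes "x \<in> carrier K - {\<zero>}"
  shows "v (x [^] (n::nat)) = int n * v x"
  by (induction n)
    (use assms v_one v_mult[OF pow_nonzero[OF assms] assms] in \<open>auto simp: algebra_simps\<close>)

text \<open>
  Because \<open>v a = v b\<close>, the three possible values correspond to \<open>v x < v y\<close>,
  \<open>v y < v x\<close> and \<open>v x = v y\<close>. In the last case the hypothesis on \<open>ac a + ac b\<close> rules out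
  cancellation.
\<close>

lemma ac_linear_combination:
  assumes "a \<in> carrier K - {\<zero>}" "b \<in> carrier K - {\<zero>}"
    and "x \<in> carrier K - {\<zero>}" "y \<in> carrier K - {\<zero>}"
    and "v a = v b" "ac a \<oplus>\<^bsub>F\<^esub> ac b \<noteq> \<zero>\<^bsub>F\<^esub>" "ac y = ac x"
  shows "ac (a \<otimes> x \<oplus> b \<otimes> y) \<in>
    {ac a \<otimes>\<^bsub>F\<^esub> ac x, ac b \<otimes>\<^bsub>F\<^esub> ac x, (ac a \<oplus>\<^bsub>F\<^esub> ac b) \<otimes>\<^bsub>F\<^esub> ac x}"
proof -
  note ax = mult_nonzero[OF assms(1,3)] and bY = mult_nonzero[OF assms(2,4)]
  note cl = ac_closed[OF assms(1)] ac_closed[OF assms(2)] ac_closed[OF assms(3)]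
  consider "v (a \<otimes> x) < v (b \<otimes> y)" | "v (b \<otimes> y) < v (a \<otimes> x)" | "v (a \<otimes> x) = v (b \<otimes> y)"
    by linarith
  then show ?thesis
  proof cases
    case 1
    then show ?thesis
      using ac_add_less[OF ax bY] ac_mult assms by simp
  next
    case 2
    then show ?thesis
      using ac_add_less[OF bY ax] ac_mult assms K.a_comm[of "a \<otimes> x" "b \<otimes> y"] by simp
  next
    case 3
    have "ac (a \<otimes> x) \<oplus>\<^bsub>F\<^esub> ac (b \<otimes> y) = (ac a \<oplus>\<^bsub>F\<^esub> ac b) \<otimes>\<^bsub>F\<^esub> ac x"
      using ac_mult assms cl by (simp add: F.l_distr)
    moreover have "\<dots> \<noteq> \<zero>\<^bsub>F\<^esub>"
      using cl assms(6) F.integral by auto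
    ultimately show ?thesis
      using ac_add_eq[OF ax bY 3] by simp
  qed
qed

text \<open>
  The heart of the matter: if all four variables have leading coefficient \<open>s\<close>, comparing both sides gives
  \<open>q * s = ac c * s * s ^ n\<close> for one of three possible values of \<open>q\<close>, and \<open>s\<close> cancels. The
  equation is stated for leading coefficients only, because representatives of a solution in the
  completion satisfy it up to a small error.
\<close>

lemma ac_equation_imp_power:
  assumes "a \<in> carrier K - {\<zero>}" "b \<in> carrier K - {\<zero>}" "c \<in> carrier K - {\<zero>}"
    and "x \<in> carrier K - {\<zero>}" "y \<in> carrier K - {\<zero>}" "w \<in> carrier K - {\<zero>}" "z \<in> carrier K - {\<zero>}"
    and "v a = v b" "ac a \<oplus>\<^bsub>F\<^esub> ac b \<noteq> \<zero>\<^bsub>F\<^esub>" "ac y = ac x" "ac w = ac x" "ac z = ac x"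
    and "ac (a \<otimes> x \<oplus> b \<otimes> y) = ac (c \<otimes> w \<otimes> z [^] (n::nat))"
  shows "\<exists>t\<in>carrier F. ac c \<otimes>\<^bsub>F\<^esub> t [^]\<^bsub>F\<^esub> n \<in> {ac a, ac b, ac a \<oplus>\<^bsub>F\<^esub> ac b}"
proof -
  note cl = ac_closed[OF assms(1)] ac_closed[OF assms(2)] ac_closed[OF assms(3)] ac_closed[OF assms(4)]
  have "ac (c \<otimes> w \<otimes> z [^] n) = ac c \<otimes>\<^bsub>F\<^esub> ac x \<otimes>\<^bsub>F\<^esub> ac x [^]\<^bsub>F\<^esub> n"
    using ac_mult[OF mult_nonzero[OF assms(3,6)] pow_nonzero[OF assms(7)]] ac_mult[OF assms(3,6)]
      ac_pow[OF assms(7)] assms(11,12) by simp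
  also have "\<dots> = (ac c \<otimes>\<^bsub>F\<^esub> ac x [^]\<^bsub>F\<^esub> n) \<otimes>\<^bsub>F\<^esub> ac x"
    using cl by (simp add: F.m_ac)
  finally have "(ac c \<otimes>\<^bsub>F\<^esub> ac x [^]\<^bsub>F\<^esub> n) \<otimes>\<^bsub>F\<^esub> ac x \<in>
    {ac a \<otimes>\<^bsub>F\<^esub> ac x, ac b \<otimes>\<^bsub>F\<^esub> ac x, (ac a \<oplus>\<^bsub>F\<^esub> ac b) \<otimes>\<^bsub>F\<^esub> ac x}"
    using ac_linear_combination[OF assms(1,2,4,5,8-10)] assms(13) by simp
  then have "ac c \<otimes>\<^bsub>F\<^esub> ac x [^]\<^bsub>F\<^esub> n \<in> {ac a, ac b, ac a \<oplus>\<^bsub>F\<^esub> ac b}"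
    using cl by (auto simp: F.m_rcancel)
  then show ?thesis
    using cl by blast
qed

end

section \<open>The completion and the colouring\<close>

locale adic_angular_component =
  angular_component K F "adic_val R K \<iota> \<pp>" ac
  for R :: "('a, 'm) ring_scheme" and K :: "('k, 'n) ring_scheme" (structure)
    and \<iota> :: "'a \<Rightarrow> 'k" and \<pp> :: "'a set"
    and F :: "('f, 'q) ring_scheme" and ac :: "'k \<Rightarrow> 'f"
begin

abbreviation "\<C> \<equiv> adic_Cauchy_ring R K \<iota> \<pp>"
abbreviation "\<N> \<equiv> adic_null R K \<iota> \<pp>"
abbreviation "v \<equiv> adic_val R K \<iota> \<pp>"

lemma adic_close_iff:
  assumes "x \<in> carrier K" "y \<in> carrier K"
  shows "adic_close R K \<iota> \<pp> N x y \<longleftrightarrow> x \<ominus> y \<in> val_ball N"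
  using assms by (auto simp: adic_close_def val_ball_def)

lemma Cauchy_iff:
  "s \<in> carrier \<C> \<longleftrightarrow>
    (\<forall>i. s i \<in> carrier K) \<and> (\<forall>N. \<exists>M. \<forall>i\<ge>M. \<forall>j\<ge>M. s i \<ominus> s j \<in> val_ball N)"
proof -
  have "range s \<subseteq> carrier K \<longleftrightarrow> (\<forall>i. s i \<in> carrier K)"
    by auto
  then show ?thesis
    by (auto simp: adic_Cauchy_ring_def adic_close_iff)
qed

lemma Cauchy_carrier: "s \<in> carrier \<C> \<Longrightarrow> s i \<in> carrier K"
  by (simp add: Cauchy_iff)

lemma null_iff:
  "s \<in> \<N> \<longleftrightarrow> s \<in> carrier \<C> \<and> (\<forall>N. \<forall>\<^sub>F i in sequentially. s i \<in> val_ball N)"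
  by (auto simp: adic_null_def eventually_sequentially adic_close_iff Cauchy_carrier a_minus_def)

lemma Cauchy_ops [simp]:
  "s \<otimes>\<^bsub>\<C>\<^esub> t = (\<lambda>i. s i \<otimes> t i)" "s \<oplus>\<^bsub>\<C>\<^esub> t = (\<lambda>i. s i \<oplus> t i)"
  "\<one>\<^bsub>\<C>\<^esub> = (\<lambda>i. \<one>)" "\<zero>\<^bsub>\<C>\<^esub> = (\<lambda>i. \<zero>)"
  by (simp_all add: adic_Cauchy_ring_def)

lemma Cauchy_pow: "s [^]\<^bsub>\<C>\<^esub> (n::nat) = (\<lambda>i. s i [^] n)"
  by (induction n) auto

lemma Cauchy_const: "x \<in> carrier K \<Longrightarrow> (\<lambda>_. x) \<in> carrier \<C>"
  by (auto simp: Cauchy_iff a_minus_def K.r_neg)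

lemma Cauchy_eventually_bounded:
  assumes "s \<in> carrier \<C>"
  obtains N where "\<forall>\<^sub>F i in sequentially. s i \<in> val_ball N"
proof -
  obtain M where M: "\<And>i j. i \<ge> M \<Longrightarrow> j \<ge> M \<Longrightarrow> s i \<ominus> s j \<in> val_ball 0"
    using assms unfolding Cauchy_iff by meson
  have "s i \<in> val_ball (min 0 (v (s M)))" if "i \<ge> M" for i
  proof -
    have "s i = (s i \<ominus> s M) \<oplus> s M"
      using Cauchy_carrier[OF assms] by (simp add: a_minus_def K.a_assoc K.l_neg)
    moreover have "s i \<ominus> s M \<in> val_ball (min 0 (v (s M)))"
      using M[of i M] that by (auto intro: val_ball_mono)
    moreover have "s M \<in> val_ball (min 0 (v (s M)))"
      using val_ball_v[OF Cauchy_carrier[OF assms]] by (rule val_ball_mono) simp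
    ultimately show ?thesis
      by (metis val_ball_add)
  qed
  then show ?thesis
    using that by (meson eventually_sequentiallyI)
qed

lemma Cauchy_add:
  assumes "s \<in> carrier \<C>" "t \<in> carrier \<C>"
  shows "(\<lambda>i. s i \<oplus> t i) \<in> carrier \<C>"
  unfolding Cauchy_iff
proof (intro conjI allI)
  show "s i \<oplus> t i \<in> carrier K" for i
    using assms by (simp add: Cauchy_carrier)
  fix N
  obtain M M' where M: "\<And>i j. i \<ge> M \<Longrightarrow> j \<ge> M \<Longrightarrow> s i \<ominus> s j \<in> val_ball N"
    and M': "\<And>i j. i \<ge> M' \<Longrightarrow> j \<ge> M' \<Longrightarrow> t i \<ominus> t j \<in> val_ball N"
    using assms unfolding Cauchy_iff by meson
  have "(s i \<oplus> t i) \<ominus> (s j \<oplus> t j) \<in> val_ball N" if "i \<ge> max M M'" "j \<ge> max M M'" for i j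
  proof -
    have "(s i \<oplus> t i) \<ominus> (s j \<oplus> t j) = (s i \<ominus> s j) \<oplus> (t i \<ominus> t j)"
      using assms[THEN Cauchy_carrier] by (simp add: a_minus_def K.minus_add K.a_ac)
    then show ?thesis
      using M[of i j] M'[of i j] that by simp
  qed
  then show "\<exists>M. \<forall>i\<ge>M. \<forall>j\<ge>M. (s i \<oplus> t i) \<ominus> (s j \<oplus> t j) \<in> val_ball N"
    by blast
qed

lemma Cauchy_mult:
  assumes "s \<in> carrier \<C>" "t \<in> carrier \<C>"
  shows "(\<lambda>i. s i \<otimes> t i) \<in> carrier \<C>"
  unfolding Cauchy_iff
proof (intro conjI allI)
  note [simp] = assms[THEN Cauchy_carrier]
  show "s i \<otimes> t i \<in> carrier K" for i
    by simp
  fix N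
  obtain B B' where "\<forall>\<^sub>F i in sequentially. s i \<in> val_ball B"
    and "\<forall>\<^sub>F i in sequentially. t i \<in> val_ball B'"
    using assms[THEN Cauchy_eventually_bounded] by metis
  then obtain L L' where L: "\<And>i. i \<ge> L \<Longrightarrow> s i \<in> val_ball B"
    and L': "\<And>i. i \<ge> L' \<Longrightarrow> t i \<in> val_ball B'"
    unfolding eventually_sequentially by meson
  obtain M M' where M: "\<And>i j. i \<ge> M \<Longrightarrow> j \<ge> M \<Longrightarrow> s i \<ominus> s j \<in> val_ball (N - B')"
    and M': "\<And>i j. i \<ge> M' \<Longrightarrow> j \<ge> M' \<Longrightarrow> t i \<ominus> t j \<in> val_ball (N - B)"
    using assms unfolding Cauchy_iff by meson
  define m where "m = max (max M M') (max L L')"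
  have "s i \<otimes> t i \<ominus> s j \<otimes> t j \<in> val_ball N" if "i \<ge> m" "j \<ge> m" for i j
  proof -
    have "s i \<otimes> t i \<ominus> s j \<otimes> t j = s i \<otimes> (t i \<ominus> t j) \<oplus> (s i \<ominus> s j) \<otimes> t j"
      by (simp add: a_minus_def K.r_distr K.l_distr K.l_minus K.r_minus K.a_assoc K.r_neg1 K.r_neg2)
    moreover have "s i \<otimes> (t i \<ominus> t j) \<in> val_ball (B + (N - B))"
      using that by (intro val_ball_mult L M') (auto simp: m_def)
    moreover have "(s i \<ominus> s j) \<otimes> t j \<in> val_ball (N - B' + B')"
      using that by (intro val_ball_mult L' M) (auto simp: m_def)
    ultimately show ?thesis
      by simp
  qed
  then show "\<exists>M. \<forall>i\<ge>M. \<forall>j\<ge>M. s i \<otimes> t i \<ominus> s j \<otimes> t j \<in> val_ball N"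
    by blast
qed

lemma Cauchy_minus:
  assumes "s \<in> carrier \<C>"
  shows "(\<lambda>i. \<ominus> s i) \<in> carrier \<C>"
proof -
  have "(\<lambda>i. \<ominus> \<one> \<otimes> s i) \<in> carrier \<C>"
    using Cauchy_mult[OF Cauchy_const assms] by simp
  then show ?thesis
    using Cauchy_carrier[OF assms] by (simp add: K.l_minus)
qed

lemma Cauchy_ring_is_cring: "cring \<C>"
proof (rule cringI)
  show "abelian_group \<C>"
  proof (rule abelian_groupI)
    show "\<exists>t\<in>carrier \<C>. t \<oplus>\<^bsub>\<C>\<^esub> s = \<zero>\<^bsub>\<C>\<^esub>" if "s \<in> carrier \<C>" for s
      using Cauchy_minus[OF that] Cauchy_carrier[OF that] by (auto simp: K.l_neg intro!: bexI)
  qed (auto simp: Cauchy_add Cauchy_const Cauchy_carrier K.a_ac)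
  show "comm_monoid \<C>"
    by (rule comm_monoidI) (auto simp: Cauchy_mult Cauchy_const Cauchy_carrier K.m_ac)
qed (auto simp: Cauchy_carrier K.l_distr)

lemma Cauchy_a_inv:
  assumes "s \<in> carrier \<C>"
  shows "\<ominus>\<^bsub>\<C>\<^esub> s = (\<lambda>i. \<ominus> s i)"
proof -
  interpret C: cring \<C>
    by (rule Cauchy_ring_is_cring)
  show ?thesis
    by (rule C.minus_equality)
      (use assms Cauchy_minus Cauchy_carrier[OF assms] in \<open>auto simp: K.l_neg\<close>)
qed

text \<open>
  Null sequences absorb Cauchy sequences because the latter are eventually bounded.
\<close>

lemma null_mult:
  assumes "s \<in> \<N>" "t \<in> carrier \<C>"
  shows "(\<lambda>i. t i \<otimes> s i) \<in> \<N>"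
proof -
  obtain B where B: "\<forall>\<^sub>F i in sequentially. t i \<in> val_ball B"
    using Cauchy_eventually_bounded[OF assms(2)] .
  have "\<forall>\<^sub>F i in sequentially. t i \<otimes> s i \<in> val_ball N" for N
  proof -
    have "\<forall>\<^sub>F i in sequentially. s i \<in> val_ball (N - B)"
      using assms(1) by (simp add: null_iff)
    with B show ?thesis
      by eventually_elim (use val_ball_mult in fastforce)
  qed
  then show ?thesis
    using assms Cauchy_mult by (simp add: null_iff)
qed

lemma null_ideal: "ideal \<N> \<C>"
proof -
  interpret C: cring \<C>
    by (rule Cauchy_ring_is_cring)
  show ?thesis
  proof (rule idealI)
    show "subgroup \<N> (add_monoid \<C>)"
    proof (rule C.add.subgroupI)
      show "\<ominus>\<^bsub>\<C>\<^esub> s \<in> \<N>" if "s \<in> \<N>" for s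
      proof -
        have "\<forall>\<^sub>F i in sequentially. \<ominus> s i \<in> val_ball N" for N
        proof -
          have "\<forall>\<^sub>F i in sequentially. s i \<in> val_ball N"
            using that by (simp add: null_iff)
          then show ?thesis
            by eventually_elim simp
        qed
        then show ?thesis
          using that by (simp add: null_iff Cauchy_a_inv Cauchy_minus)
      qed
      show "s \<oplus>\<^bsub>\<C>\<^esub> t \<in> \<N>" if "s \<in> \<N>" "t \<in> \<N>" for s t
      proof -
        have "\<forall>\<^sub>F i in sequentially. s i \<oplus> t i \<in> val_ball N" for N
        proof -
          have "\<forall>\<^sub>F i in sequentially. s i \<in> val_ball N" "\<forall>\<^sub>F i in sequentially. t i \<in> val_ball N"
            using that by (simp_all add: null_iff)
          then show ?thesis
            by eventually_elim simp
        qed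
        then show ?thesis
          using that by (simp add: null_iff Cauchy_add)
      qed
      have "(\<lambda>i. \<zero>) \<in> \<N>"
        by (simp add: null_iff Cauchy_const)
      then show "\<N> \<noteq> {}"
        by blast
    qed (auto simp: null_iff)
    show "t \<otimes>\<^bsub>\<C>\<^esub> s \<in> \<N>" if "s \<in> \<N>" "t \<in> carrier \<C>" for s t
      using null_mult[OF that] by simp
    then show "s \<otimes>\<^bsub>\<C>\<^esub> t \<in> \<N>" if "s \<in> \<N>" "t \<in> carrier \<C>" for s t
      using that C.m_comm[of s t] by (metis null_iff)
  qed (rule C.ring_axioms)
qed

definition eventual_ac :: "(nat \<Rightarrow> 'k) \<Rightarrow> 'f \<Rightarrow> bool" where
  "eventual_ac s q \<longleftrightarrow> (\<exists>k. \<forall>\<^sub>F i in sequentially. s i \<in> carrier K - {\<zero>} \<and> v (s i) = k \<and> ac (s i) = q)"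

text \<open>
  A Cauchy sequence that is not null has infinitely many terms outside some ball around zero.
  Beyond the point where its terms differ by elements of that ball, one such term fixes the leading
  terms of all others.
\<close>

lemma eventual_ac_exists:
  assumes "s \<in> carrier \<C>" "s \<notin> \<N>"
  shows "\<exists>q. eventual_ac s q"
proof -
  obtain N where N: "\<exists>\<^sub>F i in sequentially. s i \<notin> val_ball N"
    using assms by (auto simp: null_iff not_eventually)
  obtain M where M: "\<And>i j. i \<ge> M \<Longrightarrow> j \<ge> M \<Longrightarrow> s i \<ominus> s j \<in> val_ball N"
    using assms unfolding Cauchy_iff by meson
  obtain i where i: "i \<ge> M" "s i \<notin> val_ball N"
    using N by (metis frequently_sequentially)
  have si: "s i \<in> carrier K - {\<zero>}" "v (s i) + 1 \<le> N"
    using i Cauchy_carrier[OF assms(1)] by (auto simp: val_ball_def)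
  have "s j \<in> carrier K - {\<zero>} \<and> v (s j) = v (s i) \<and> ac (s j) = ac (s i)" if "j \<ge> M" for j
    using ac_perturb[OF si(1) Cauchy_carrier[OF assms(1), of j] val_ball_mono[OF M[OF that i(1)] si(2)]]
      Cauchy_carrier[OF assms(1)] by simp
  then have "eventual_ac s (ac (s i))"
    unfolding eventual_ac_def eventually_sequentially by blast
  then show ?thesis ..
qed

lemma completion_coset_eq_iff:
  assumes "s \<in> carrier \<C>" "t \<in> carrier \<C>"
  shows "\<N> +>\<^bsub>\<C>\<^esub> s = \<N> +>\<^bsub>\<C>\<^esub> t \<longleftrightarrow> (\<lambda>i. s i \<ominus> t i) \<in> \<N>"
proof -
  interpret C: cring \<C>
    by (rule Cauchy_ring_is_cring)
  show ?thesis
    using C.quotient_eq_iff_same_a_r_cos[OF null_ideal assms] assms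
    by (simp add: a_minus_def Cauchy_a_inv)
qed

text \<open>
  Nonzero elements of the completion are coloured by the leading coefficient of a representing
  sequence. The representative may be chosen arbitrarily: a solution of the equation in the
  completion gives representatives that satisfy it up to a null sequence, and a late enough
  index then gives elements of \<open>K\<close> to which \<open>ac_equation_imp_power\<close> applies.
\<close>

theorem completion_not_partition_regular:
  fixes n :: nat
  assumes ab: "a \<in> carrier R" "b \<in> carrier R" "c \<in> carrier R"
    and img: "\<iota> a \<in> carrier K - {\<zero>}" "\<iota> b \<in> carrier K - {\<zero>}" "\<iota> c \<in> carrier K - {\<zero>}"
    and "v (\<iota> a) = v (\<iota> b)" "ac (\<iota> a) \<oplus>\<^bsub>F\<^esub> ac (\<iota> b) \<noteq> \<zero>\<^bsub>F\<^esub>"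
    and "finite (carrier F)"
    and no_power: "\<And>t. t \<in> carrier F \<Longrightarrow>
      ac (\<iota> c) \<otimes>\<^bsub>F\<^esub> t [^]\<^bsub>F\<^esub> n \<notin> {ac (\<iota> a), ac (\<iota> b), ac (\<iota> a) \<oplus>\<^bsub>F\<^esub> ac (\<iota> b)}"
  defines "Kp \<equiv> adic_completion R K \<iota> \<pp>"
    and "j \<equiv> to_completion R K \<iota> \<pp>"
  shows "\<not> partition_regular_over (carrier Kp - {\<zero>\<^bsub>Kp\<^esub>})
           (\<lambda>w x y z. (j a \<otimes>\<^bsub>Kp\<^esub> x) \<oplus>\<^bsub>Kp\<^esub> (j b \<otimes>\<^bsub>Kp\<^esub> y)
                        = j c \<otimes>\<^bsub>Kp\<^esub> w \<otimes>\<^bsub>Kp\<^esub> (z [^]\<^bsub>Kp\<^esub> n))"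
proof
  interpret C: cring \<C>
    by (rule Cauchy_ring_is_cring)
  interpret N: ideal \<N> \<C>
    by (rule null_ideal)
  let ?\<pi> = "\<lambda>s. \<N> +>\<^bsub>\<C>\<^esub> s"
  have Kp: "Kp = \<C> Quot \<N>"
    by (simp add: Kp_def adic_completion_def)
  interpret \<pi>: ring_hom_ring \<C> Kp ?\<pi>
    unfolding Kp by (rule N.rcos_ring_hom_ring)
  have rep: "\<exists>s q. s \<in> carrier \<C> \<and> X' = ?\<pi> s \<and> eventual_ac s q" if "X' \<in> carrier Kp - {\<zero>\<^bsub>Kp\<^esub>}" for X'
  proof -
    have "X' \<in> a_rcosets\<^bsub>\<C>\<^esub> \<N>"
      using that by (simp add: Kp FactRing_def)
    then obtain s where s: "s \<in> carrier \<C>" "X' = ?\<pi> s"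
      by (auto simp: A_RCOSETS_def')
    then have "s \<notin> \<N>"
      using that C.a_rcos_zero[OF null_ideal] by (auto simp: Kp FactRing_def)
    then show ?thesis
      using eventual_ac_exists s by blast
  qed
  then obtain rep col where rep: "\<And>X'. X' \<in> carrier Kp - {\<zero>\<^bsub>Kp\<^esub>} \<Longrightarrow>
      rep X' \<in> carrier \<C> \<and> X' = ?\<pi> (rep X') \<and> eventual_ac (rep X') (col X')"
    by metis
  have col_carrier: "col X' \<in> carrier F" if X': "X' \<in> carrier Kp - {\<zero>\<^bsub>Kp\<^esub>}" for X'
  proof -
    obtain i where "rep X' i \<in> carrier K - {\<zero>}" "ac (rep X' i) = col X'"
      using rep[OF X'] unfolding eventual_ac_def eventually_sequentially by blast
    then show ?thesis
      using ac_closed[of "rep X' i"] by simp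
  qed
  have fin: "finite (col ` (carrier Kp - {\<zero>\<^bsub>Kp\<^esub>}))"
    by (rule finite_subset[OF image_subsetI[OF col_carrier] \<open>finite (carrier F)\<close>])
  assume "partition_regular_over (carrier Kp - {\<zero>\<^bsub>Kp\<^esub>})
           (\<lambda>w x y z. (j a \<otimes>\<^bsub>Kp\<^esub> x) \<oplus>\<^bsub>Kp\<^esub> (j b \<otimes>\<^bsub>Kp\<^esub> y)
                        = j c \<otimes>\<^bsub>Kp\<^esub> w \<otimes>\<^bsub>Kp\<^esub> (z [^]\<^bsub>Kp\<^esub> n))"
  then obtain W' X' Y' Z'
    where mem: "W' \<in> carrier Kp - {\<zero>\<^bsub>Kp\<^esub>}" "X' \<in> carrier Kp - {\<zero>\<^bsub>Kp\<^esub>}"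
      "Y' \<in> carrier Kp - {\<zero>\<^bsub>Kp\<^esub>}" "Z' \<in> carrier Kp - {\<zero>\<^bsub>Kp\<^esub>}"
      and col: "col X' = col W'" "col Y' = col W'" "col Z' = col W'"
      and eq: "(j a \<otimes>\<^bsub>Kp\<^esub> X') \<oplus>\<^bsub>Kp\<^esub> (j b \<otimes>\<^bsub>Kp\<^esub> Y') = j c \<otimes>\<^bsub>Kp\<^esub> W' \<otimes>\<^bsub>Kp\<^esub> (Z' [^]\<^bsub>Kp\<^esub> n)"
    by (rule partition_regular_over_coloring[OF _ fin])
  define w x y z where "w = rep W'" and "x = rep X'" and "y = rep Y'" and "z = rep Z'"
  note seqs = rep[OF mem(1), folded w_def] rep[OF mem(2), folded x_def]
    rep[OF mem(3), folded y_def] rep[OF mem(4), folded z_def]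
  then have cl: "w \<in> carrier \<C>" "x \<in> carrier \<C>" "y \<in> carrier \<C>" "z \<in> carrier \<C>"
    and const_seqs: "(\<lambda>_. \<iota> a) \<in> carrier \<C>" "(\<lambda>_. \<iota> b) \<in> carrier \<C>" "(\<lambda>_. \<iota> c) \<in> carrier \<C>"
    using img by (auto intro: Cauchy_const)
  define f where "f = (\<lambda>i. \<iota> a \<otimes> x i \<oplus> \<iota> b \<otimes> y i)"
  define g where "g = (\<lambda>i. \<iota> c \<otimes> w i \<otimes> z i [^] n)"
  have f_alt: "f = (\<lambda>_. \<iota> a) \<otimes>\<^bsub>\<C>\<^esub> x \<oplus>\<^bsub>\<C>\<^esub> (\<lambda>_. \<iota> b) \<otimes>\<^bsub>\<C>\<^esub> y"
    and g_alt: "g = (\<lambda>_. \<iota> c) \<otimes>\<^bsub>\<C>\<^esub> w \<otimes>\<^bsub>\<C>\<^esub> z [^]\<^bsub>\<C>\<^esub> n"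
    by (simp_all add: f_def g_def Cauchy_pow)
  have fg: "f \<in> carrier \<C>" "g \<in> carrier \<C>"
    unfolding f_alt g_alt using cl const_seqs by (intro C.a_closed C.m_closed C.nat_pow_closed; simp)+
  have "?\<pi> f = j a \<otimes>\<^bsub>Kp\<^esub> ?\<pi> x \<oplus>\<^bsub>Kp\<^esub> j b \<otimes>\<^bsub>Kp\<^esub> ?\<pi> y"
    unfolding f_alt j_def to_completion_def
    using cl const_seqs by (simp only: \<pi>.hom_add \<pi>.hom_mult C.m_closed)
  moreover have "?\<pi> g = j c \<otimes>\<^bsub>Kp\<^esub> ?\<pi> w \<otimes>\<^bsub>Kp\<^esub> ?\<pi> z [^]\<^bsub>Kp\<^esub> n"
    unfolding g_alt j_def to_completion_def
    using cl const_seqs by (simp only: \<pi>.hom_nat_pow \<pi>.hom_mult C.m_closed C.nat_pow_closed)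
  ultimately have "?\<pi> f = ?\<pi> g"
    using eq seqs by metis
  then have null: "(\<lambda>i. f i \<ominus> g i) \<in> \<N>"
    using completion_coset_eq_iff[OF fg] by simp
  have "eventual_ac w (col W')" "eventual_ac x (col W')" "eventual_ac y (col W')" "eventual_ac z (col W')"
    using seqs[unfolded col] by blast+
  then obtain kw kx ky kz where
    "\<forall>\<^sub>F i in sequentially. w i \<in> carrier K - {\<zero>} \<and> v (w i) = kw \<and> ac (w i) = col W'"
    "\<forall>\<^sub>F i in sequentially. x i \<in> carrier K - {\<zero>} \<and> v (x i) = kx \<and> ac (x i) = col W'"
    "\<forall>\<^sub>F i in sequentially. y i \<in> carrier K - {\<zero>} \<and> v (y i) = ky \<and> ac (y i) = col W'"
    "\<forall>\<^sub>F i in sequentially. z i \<in> carrier K - {\<zero>} \<and> v (z i) = kz \<and> ac (z i) = col W'"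
    unfolding eventual_ac_def by (elim exE) (rule that)
  moreover have "\<forall>\<^sub>F i in sequentially. f i \<ominus> g i \<in> val_ball (v (\<iota> c) + kw + int n * kz + 1)"
    using null by (simp add: null_iff)
  ultimately have "\<forall>\<^sub>F i in sequentially. False"
  proof eventually_elim
    case (elim i)
    then have nz: "w i \<in> carrier K - {\<zero>}" "x i \<in> carrier K - {\<zero>}"
      "y i \<in> carrier K - {\<zero>}" "z i \<in> carrier K - {\<zero>}"
      by auto
    have gi: "g i \<in> carrier K - {\<zero>}"
      unfolding g_def by (intro mult_nonzero pow_nonzero nz img)
    \<comment> \<open>The error bound exceeds the valuation of the right-hand side by one, which is all that is
      needed for equal leading coefficients.\<close>
    have "v (g i) = v (\<iota> c) + kw + int n * kz"
      using elim nz img v_mult mult_nonzero pow_nonzero v_pow by (simp add: g_def)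
    then have "ac (f i) = ac (g i)"
      using ac_perturb(3)[OF gi Cauchy_carrier[OF fg(1)]] elim by simp
    then have "\<exists>t\<in>carrier F. ac (\<iota> c) \<otimes>\<^bsub>F\<^esub> t [^]\<^bsub>F\<^esub> n \<in>
        {ac (\<iota> a), ac (\<iota> b), ac (\<iota> a) \<oplus>\<^bsub>F\<^esub> ac (\<iota> b)}"
      using elim assms(7,8)
      by (intro ac_equation_imp_power[OF img nz(2,3,1,4)]) (simp_all add: f_def g_def)
    then show False
      using no_power by blast
  qed
  then show False
    by simp
qed

end

section \<open>Leading terms from a uniformizer\<close>

text \<open>
  The localization of \<open>R\<close> at the kernel of \<open>\<phi>\<close> is a discrete valuation ring with uniformizer
  \<open>\<pi>\<close>, expressed inside \<open>R\<close>: a unit of the localization is a quotient of elements with nonzero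
  residue. Asking for \<open>\<phi> t = 1\<close>, which can always be achieved by scaling, makes
  \<open>\<phi> u\<close> the leading coefficient of \<open>x\<close>, without a division in the residue field.
\<close>

locale residue_uniformizer =
  fraction_field R K \<iota> + F: field F
  for R :: "('a, 'm) ring_scheme" and K :: "('k, 'n) ring_scheme" and \<iota> :: "'a \<Rightarrow> 'k"
    and F :: "('f, 'q) ring_scheme" +
  fixes \<phi> :: "'a \<Rightarrow> 'f" and \<pi> :: 'a
  assumes residue_hom: "\<phi> \<in> ring_hom R F"
    and residue_surj: "\<phi> ` carrier R = carrier F"
    and \<pi>_carrier [simp]: "\<pi> \<in> carrier R" and \<pi>_nonzero: "\<pi> \<noteq> \<zero>\<^bsub>R\<^esub>"
    and residue_\<pi> [simp]: "\<phi> \<pi> = \<zero>\<^bsub>F\<^esub>"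
    and factorization: "x \<in> carrier R - {\<zero>\<^bsub>R\<^esub>} \<Longrightarrow>
      \<exists>t\<in>carrier R. \<exists>u\<in>carrier R. \<exists>k. \<phi> t = \<one>\<^bsub>F\<^esub> \<and> \<phi> u \<noteq> \<zero>\<^bsub>F\<^esub> \<and>
        t \<otimes>\<^bsub>R\<^esub> x = u \<otimes>\<^bsub>R\<^esub> \<pi> [^]\<^bsub>R\<^esub> (k::nat)"
begin

sublocale \<phi>: ring_hom_cring R F \<phi>
  by (intro ring_hom_cring.intro ring_hom_cring_axioms.intro R.is_cring F.is_cring residue_hom)

sublocale \<iota>: ring_hom_cring R K \<iota>
  by (intro ring_hom_cring.intro ring_hom_cring_axioms.intro R.is_cring K.is_cring embed_hom)

lemma embed_eq_iff: "x \<in> carrier R \<Longrightarrow> y \<in> carrier R \<Longrightarrow> \<iota> x = \<iota> y \<longleftrightarrow> x = y"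
  using embed_inj by (auto dest: inj_onD)

lemma embed_nonzero: "x \<in> carrier R - {\<zero>\<^bsub>R\<^esub>} \<Longrightarrow> \<iota> x \<in> carrier K - {\<zero>\<^bsub>K\<^esub>}"
  using embed_eq_iff[of x "\<zero>\<^bsub>R\<^esub>"] by simp

lemma \<pi>_pow_nonzero: "\<pi> [^]\<^bsub>R\<^esub> (k::nat) \<noteq> \<zero>\<^bsub>R\<^esub>"
  by (induction k) (auto simp: R.integral_iff \<pi>_nonzero)

lemma unit_part_unique_le:
  assumes "a \<in> carrier R" "b \<in> carrier R" "\<phi> a \<noteq> \<zero>\<^bsub>F\<^esub>"
    and eq: "a \<otimes>\<^bsub>R\<^esub> \<pi> [^]\<^bsub>R\<^esub> i = b \<otimes>\<^bsub>R\<^esub> \<pi> [^]\<^bsub>R\<^esub> j" and "i \<le> (j::nat)"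
  shows "i = j \<and> a = b"
proof -
  have "a \<otimes>\<^bsub>R\<^esub> \<pi> [^]\<^bsub>R\<^esub> i = (b \<otimes>\<^bsub>R\<^esub> \<pi> [^]\<^bsub>R\<^esub> (j - i)) \<otimes>\<^bsub>R\<^esub> \<pi> [^]\<^bsub>R\<^esub> i"
    using eq assms(1,2,5) by (simp add: R.m_assoc R.nat_pow_mult)
  then have *: "a = b \<otimes>\<^bsub>R\<^esub> \<pi> [^]\<^bsub>R\<^esub> (j - i)"
    using assms(1,2) \<pi>_pow_nonzero R.m_rcancel[of "\<pi> [^]\<^bsub>R\<^esub> i"] by simp
  have "j - i = 0"
  proof (rule ccontr)
    assume "j - i \<noteq> 0"
    then obtain d where "j - i = Suc d"
      by (cases "j - i") auto
    then have "\<phi> a = \<zero>\<^bsub>F\<^esub>"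
      using * assms(1,2) by simp
    then show False
      using assms(3) by simp
  qed
  then show ?thesis
    using * assms by simp
qed

lemma unit_part_unique:
  assumes "a \<in> carrier R" "b \<in> carrier R" "\<phi> a \<noteq> \<zero>\<^bsub>F\<^esub>" "\<phi> b \<noteq> \<zero>\<^bsub>F\<^esub>"
    and "a \<otimes>\<^bsub>R\<^esub> \<pi> [^]\<^bsub>R\<^esub> i = b \<otimes>\<^bsub>R\<^esub> \<pi> [^]\<^bsub>R\<^esub> (j::nat)"
  shows "i = j \<and> a = b"
  using unit_part_unique_le[of a b i j] unit_part_unique_le[of b a j i] assms
  by (cases "i \<le> j") auto

text \<open>
  In effect \<open>x = (u / t) * \<pi> ^ (l - m)\<close>, with the two powers kept on separate sides to avoid
  negative exponents.
\<close>

definition expansion :: "'k \<Rightarrow> 'a \<Rightarrow> nat \<Rightarrow> 'a \<Rightarrow> nat \<Rightarrow> bool" where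
  "expansion x u l t m \<longleftrightarrow> x \<in> carrier K \<and> u \<in> carrier R \<and> t \<in> carrier R \<and> \<phi> t = \<one>\<^bsub>F\<^esub> \<and>
     x \<otimes>\<^bsub>K\<^esub> \<iota> (t \<otimes>\<^bsub>R\<^esub> \<pi> [^]\<^bsub>R\<^esub> m) = \<iota> (u \<otimes>\<^bsub>R\<^esub> \<pi> [^]\<^bsub>R\<^esub> l)"

definition leading_term :: "'k \<Rightarrow> int \<Rightarrow> 'f \<Rightarrow> bool" where
  "leading_term x k q \<longleftrightarrow> q \<noteq> \<zero>\<^bsub>F\<^esub> \<and>
     (\<exists>u l t m. expansion x u l t m \<and> q = \<phi> u \<and> k = int l - int m)"

lemma expansion_mult:
  assumes "expansion x u l t m" "expansion y u' l' t' m'"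
  shows "expansion (x \<otimes>\<^bsub>K\<^esub> y) (u \<otimes>\<^bsub>R\<^esub> u') (l + l') (t \<otimes>\<^bsub>R\<^esub> t') (m + m')"
proof -
  have cl: "x \<in> carrier K" "y \<in> carrier K" "u \<in> carrier R" "u' \<in> carrier R" "t \<in> carrier R" "t' \<in> carrier R"
    using assms by (auto simp: expansion_def)
  have "x \<otimes>\<^bsub>K\<^esub> y \<otimes>\<^bsub>K\<^esub> \<iota> (t \<otimes>\<^bsub>R\<^esub> t' \<otimes>\<^bsub>R\<^esub> \<pi> [^]\<^bsub>R\<^esub> (m + m'))
    = (x \<otimes>\<^bsub>K\<^esub> \<iota> (t \<otimes>\<^bsub>R\<^esub> \<pi> [^]\<^bsub>R\<^esub> m)) \<otimes>\<^bsub>K\<^esub> (y \<otimes>\<^bsub>K\<^esub> \<iota> (t' \<otimes>\<^bsub>R\<^esub> \<pi> [^]\<^bsub>R\<^esub> m'))"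
    using cl by (simp add: R.nat_pow_mult[symmetric] K.m_ac)
  also have "\<dots> = \<iota> (u \<otimes>\<^bsub>R\<^esub> \<pi> [^]\<^bsub>R\<^esub> l) \<otimes>\<^bsub>K\<^esub> \<iota> (u' \<otimes>\<^bsub>R\<^esub> \<pi> [^]\<^bsub>R\<^esub> l')"
    using assms by (simp only: expansion_def)
  also have "\<dots> = \<iota> (u \<otimes>\<^bsub>R\<^esub> u' \<otimes>\<^bsub>R\<^esub> \<pi> [^]\<^bsub>R\<^esub> (l + l'))"
    using cl by (simp add: R.nat_pow_mult[symmetric] K.m_ac)
  finally show ?thesis
    using assms by (simp add: expansion_def)
qed

lemma leading_term_mult:
  assumes "leading_term x k q" "leading_term y k' q'"
  shows "leading_term (x \<otimes>\<^bsub>K\<^esub> y) (k + k') (q \<otimes>\<^bsub>F\<^esub> q')"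
proof -
  obtain u l t m u' l' t' m' where *: "expansion x u l t m" "q = \<phi> u" "k = int l - int m"
    "expansion y u' l' t' m'" "q' = \<phi> u'" "k' = int l' - int m'" "q \<noteq> \<zero>\<^bsub>F\<^esub>" "q' \<noteq> \<zero>\<^bsub>F\<^esub>"
    using assms unfolding leading_term_def by metis
  then have u: "u \<in> carrier R" "u' \<in> carrier R"
    by (auto simp: expansion_def)
  then have "q \<otimes>\<^bsub>F\<^esub> q' \<noteq> \<zero>\<^bsub>F\<^esub>"
    using * F.integral[of q q'] by auto
  moreover have "q \<otimes>\<^bsub>F\<^esub> q' = \<phi> (u \<otimes>\<^bsub>R\<^esub> u')" "k + k' = int (l + l') - int (m + m')"
    using * u by auto
  ultimately show ?thesis
    unfolding leading_term_def using expansion_mult[OF *(1,4)] by blast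
qed

lemma expansion_cross:
  assumes "expansion x u l t m" "t' \<in> carrier R"
  shows "x \<otimes>\<^bsub>K\<^esub> \<iota> (t \<otimes>\<^bsub>R\<^esub> t' \<otimes>\<^bsub>R\<^esub> \<pi> [^]\<^bsub>R\<^esub> (m + m'))
    = \<iota> (u \<otimes>\<^bsub>R\<^esub> t' \<otimes>\<^bsub>R\<^esub> \<pi> [^]\<^bsub>R\<^esub> (l + m'))"
proof -
  have cl: "x \<in> carrier K" "u \<in> carrier R" "t \<in> carrier R"
    using assms by (auto simp: expansion_def)
  have "x \<otimes>\<^bsub>K\<^esub> \<iota> (t \<otimes>\<^bsub>R\<^esub> t' \<otimes>\<^bsub>R\<^esub> \<pi> [^]\<^bsub>R\<^esub> (m + m'))
    = (x \<otimes>\<^bsub>K\<^esub> \<iota> (t \<otimes>\<^bsub>R\<^esub> \<pi> [^]\<^bsub>R\<^esub> m)) \<otimes>\<^bsub>K\<^esub> \<iota> (t' \<otimes>\<^bsub>R\<^esub> \<pi> [^]\<^bsub>R\<^esub> m')"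
    using cl assms(2) by (simp add: R.nat_pow_mult[symmetric] K.m_ac)
  also have "\<dots> = \<iota> (u \<otimes>\<^bsub>R\<^esub> \<pi> [^]\<^bsub>R\<^esub> l) \<otimes>\<^bsub>K\<^esub> \<iota> (t' \<otimes>\<^bsub>R\<^esub> \<pi> [^]\<^bsub>R\<^esub> m')"
    using assms(1) by (simp only: expansion_def)
  also have "\<dots> = \<iota> (u \<otimes>\<^bsub>R\<^esub> t' \<otimes>\<^bsub>R\<^esub> \<pi> [^]\<^bsub>R\<^esub> (l + m'))"
    using cl assms(2) by (simp add: R.nat_pow_mult[symmetric] K.m_ac)
  finally show ?thesis .
qed

lemma leading_term_unique:
  assumes "leading_term x k q" "leading_term x k' q'"
  shows "k = k' \<and> q = q'"
proof -
  obtain u l t m u' l' t' m' where *: "expansion x u l t m" "q = \<phi> u" "k = int l - int m"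
    "expansion x u' l' t' m'" "q' = \<phi> u'" "k' = int l' - int m'" "q \<noteq> \<zero>\<^bsub>F\<^esub>" "q' \<noteq> \<zero>\<^bsub>F\<^esub>"
    using assms unfolding leading_term_def by metis
  then have cl: "u \<in> carrier R" "u' \<in> carrier R" "t \<in> carrier R" "t' \<in> carrier R"
    and one: "\<phi> t = \<one>\<^bsub>F\<^esub>" "\<phi> t' = \<one>\<^bsub>F\<^esub>"
    by (auto simp: expansion_def)
  have "\<iota> (u \<otimes>\<^bsub>R\<^esub> t' \<otimes>\<^bsub>R\<^esub> \<pi> [^]\<^bsub>R\<^esub> (l + m')) = \<iota> (u' \<otimes>\<^bsub>R\<^esub> t \<otimes>\<^bsub>R\<^esub> \<pi> [^]\<^bsub>R\<^esub> (l' + m))"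
    using expansion_cross[OF *(1) cl(4), of m'] expansion_cross[OF *(4) cl(3), of m] cl
    by (simp only: R.m_comm[of t t'] add.commute[of m m'])
  from inj_onD[OF embed_inj this]
  have "u \<otimes>\<^bsub>R\<^esub> t' \<otimes>\<^bsub>R\<^esub> \<pi> [^]\<^bsub>R\<^esub> (l + m') = u' \<otimes>\<^bsub>R\<^esub> t \<otimes>\<^bsub>R\<^esub> \<pi> [^]\<^bsub>R\<^esub> (l' + m)"
    using cl by simp
  then have eq: "l + m' = l' + m" "u \<otimes>\<^bsub>R\<^esub> t' = u' \<otimes>\<^bsub>R\<^esub> t"
    using unit_part_unique[of "u \<otimes>\<^bsub>R\<^esub> t'" "u' \<otimes>\<^bsub>R\<^esub> t"] cl one * by simp_all
  have "q = \<phi> (u \<otimes>\<^bsub>R\<^esub> t')"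
    using cl one * by simp
  also have "\<dots> = q'"
    unfolding eq using cl one * by simp
  finally show ?thesis
    using eq(1) * by simp
qed

lemma leading_term_nonzero:
  assumes "leading_term x k q"
  shows "x \<in> carrier K - {\<zero>\<^bsub>K\<^esub>}"
proof -
  obtain u l t m where *: "expansion x u l t m" "q = \<phi> u" "q \<noteq> \<zero>\<^bsub>F\<^esub>"
    using assms unfolding leading_term_def by metis
  then have cl: "x \<in> carrier K" "u \<in> carrier R" "t \<in> carrier R"
    by (auto simp: expansion_def)
  have "u \<noteq> \<zero>\<^bsub>R\<^esub>"
    using * by auto
  then have "u \<otimes>\<^bsub>R\<^esub> \<pi> [^]\<^bsub>R\<^esub> l \<in> carrier R - {\<zero>\<^bsub>R\<^esub>}"
    using cl \<pi>_pow_nonzero by (simp add: R.integral_iff)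
  then have "x \<otimes>\<^bsub>K\<^esub> \<iota> (t \<otimes>\<^bsub>R\<^esub> \<pi> [^]\<^bsub>R\<^esub> m) \<noteq> \<zero>\<^bsub>K\<^esub>"
    using * embed_nonzero unfolding expansion_def by (metis DiffD2 singletonI)
  then show ?thesis
    using cl by auto
qed

lemma leading_term_embed:
  assumes "t \<in> carrier R" "u \<in> carrier R" "x \<in> carrier R" "\<phi> t = \<one>\<^bsub>F\<^esub>" "\<phi> u \<noteq> \<zero>\<^bsub>F\<^esub>"
    and "t \<otimes>\<^bsub>R\<^esub> x = u \<otimes>\<^bsub>R\<^esub> \<pi> [^]\<^bsub>R\<^esub> (k::nat)"
  shows "leading_term (\<iota> x) (int k) (\<phi> u)"
proof -
  have "\<iota> x \<otimes>\<^bsub>K\<^esub> \<iota> (t \<otimes>\<^bsub>R\<^esub> \<pi> [^]\<^bsub>R\<^esub> (0::nat)) = \<iota> (t \<otimes>\<^bsub>R\<^esub> x)"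
    using assms(1-3) by (simp add: K.m_comm)
  then have "expansion (\<iota> x) u k t 0"
    using assms by (simp add: expansion_def)
  then show ?thesis
    using assms(5) unfolding leading_term_def by force
qed

text \<open>
  Writing \<open>x = u / w\<close> and factoring \<open>t * u = a * \<pi> ^ k\<close> and \<open>s * w = b * \<pi> ^ m\<close> gives
  \<open>x = (s * a) / (b * t) * \<pi> ^ (k - m)\<close>. Multiplying numerator and denominator by some \<open>c\<close> with
  \<open>\<phi> (c * b) = 1\<close> normalizes the residue of the denominator.
\<close>

lemma leading_term_exists:
  assumes "x \<in> carrier K - {\<zero>\<^bsub>K\<^esub>}"
  shows "\<exists>k q. leading_term x k q"
proof -
  obtain u w where u: "u \<in> carrier R" and w: "w \<in> carrier R - {\<zero>\<^bsub>R\<^esub>}"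
    and x: "x = \<iota> u \<otimes>\<^bsub>K\<^esub> inv\<^bsub>K\<^esub> (\<iota> w)"
    using embed_quotients assms by blast
  have w': "\<iota> w \<in> carrier K - {\<zero>\<^bsub>K\<^esub>}" "inv\<^bsub>K\<^esub> (\<iota> w) \<in> carrier K" "inv\<^bsub>K\<^esub> (\<iota> w) \<otimes>\<^bsub>K\<^esub> \<iota> w = \<one>\<^bsub>K\<^esub>"
    using embed_nonzero[OF w] K.field_Units K.Units_inv_closed K.Units_l_inv by auto
  then have xw: "x \<otimes>\<^bsub>K\<^esub> \<iota> w = \<iota> u"
    using x u by (simp add: K.m_assoc)
  have "u \<noteq> \<zero>\<^bsub>R\<^esub>"
    using x w' assms by auto
  then obtain t a k where a: "t \<in> carrier R" "a \<in> carrier R" "\<phi> t = \<one>\<^bsub>F\<^esub>" "\<phi> a \<noteq> \<zero>\<^bsub>F\<^esub>"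
    "t \<otimes>\<^bsub>R\<^esub> u = a \<otimes>\<^bsub>R\<^esub> \<pi> [^]\<^bsub>R\<^esub> (k::nat)"
    using factorization[of u] u by auto
  obtain s b m where b: "s \<in> carrier R" "b \<in> carrier R" "\<phi> s = \<one>\<^bsub>F\<^esub>" "\<phi> b \<noteq> \<zero>\<^bsub>F\<^esub>"
    "s \<otimes>\<^bsub>R\<^esub> w = b \<otimes>\<^bsub>R\<^esub> \<pi> [^]\<^bsub>R\<^esub> (m::nat)"
    using factorization[of w] w by auto
  have "\<phi> b \<in> Units F"
    using b F.field_Units by auto
  then obtain c where c: "c \<in> carrier R" "\<phi> c \<otimes>\<^bsub>F\<^esub> \<phi> b = \<one>\<^bsub>F\<^esub>"
    using residue_surj F.Units_l_inv F.Units_inv_closed by (metis imageE)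
  have "x \<otimes>\<^bsub>K\<^esub> \<iota> (c \<otimes>\<^bsub>R\<^esub> b \<otimes>\<^bsub>R\<^esub> t \<otimes>\<^bsub>R\<^esub> \<pi> [^]\<^bsub>R\<^esub> m)
    = x \<otimes>\<^bsub>K\<^esub> \<iota> (c \<otimes>\<^bsub>R\<^esub> t \<otimes>\<^bsub>R\<^esub> (b \<otimes>\<^bsub>R\<^esub> \<pi> [^]\<^bsub>R\<^esub> m))"
    using a b c by (simp add: R.m_ac)
  also have "\<dots> = (x \<otimes>\<^bsub>K\<^esub> \<iota> w) \<otimes>\<^bsub>K\<^esub> \<iota> (c \<otimes>\<^bsub>R\<^esub> s \<otimes>\<^bsub>R\<^esub> t)"
    unfolding b(5)[symmetric] using assms a(1,2) b(1,2) c(1) w by (simp add: K.m_ac)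
  also have "\<dots> = \<iota> (c \<otimes>\<^bsub>R\<^esub> s \<otimes>\<^bsub>R\<^esub> (t \<otimes>\<^bsub>R\<^esub> u))"
    unfolding xw using a(1,2) b(1,2) c(1) u by (simp add: K.m_ac)
  also have "\<dots> = \<iota> (c \<otimes>\<^bsub>R\<^esub> s \<otimes>\<^bsub>R\<^esub> a \<otimes>\<^bsub>R\<^esub> \<pi> [^]\<^bsub>R\<^esub> k)"
    unfolding a(5) using a(1,2) b(1,2) c(1) by (simp add: K.m_ac)
  finally have "expansion x (c \<otimes>\<^bsub>R\<^esub> s \<otimes>\<^bsub>R\<^esub> a) k (c \<otimes>\<^bsub>R\<^esub> b \<otimes>\<^bsub>R\<^esub> t) m"
    using assms a b c by (simp add: expansion_def)
  moreover have "\<phi> c \<noteq> \<zero>\<^bsub>F\<^esub>"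
    using b c by auto
  then have "\<phi> (c \<otimes>\<^bsub>R\<^esub> s \<otimes>\<^bsub>R\<^esub> a) \<noteq> \<zero>\<^bsub>F\<^esub>"
    using a b c F.integral[of "\<phi> c" "\<phi> a"] by auto
  ultimately show ?thesis
    unfolding leading_term_def by blast
qed

text \<open>
  Common denominators, with the lower power of \<open>\<pi>\<close> factored out of the numerator. For \<open>d > 0\<close>
  the second summand in the numerator has residue zero.
\<close>

lemma expansion_add:
  assumes "expansion x u l t m" "expansion y u' l' t' m'" "l + m' + d = l' + m"
  shows "expansion (x \<oplus>\<^bsub>K\<^esub> y) (u \<otimes>\<^bsub>R\<^esub> t' \<oplus>\<^bsub>R\<^esub> u' \<otimes>\<^bsub>R\<^esub> t \<otimes>\<^bsub>R\<^esub> \<pi> [^]\<^bsub>R\<^esub> d) (l + m') (t \<otimes>\<^bsub>R\<^esub> t') (m + m')"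
proof -
  have cl: "x \<in> carrier K" "y \<in> carrier K" "u \<in> carrier R" "u' \<in> carrier R" "t \<in> carrier R" "t' \<in> carrier R"
    using assms by (auto simp: expansion_def)
  have "(x \<oplus>\<^bsub>K\<^esub> y) \<otimes>\<^bsub>K\<^esub> \<iota> (t \<otimes>\<^bsub>R\<^esub> t' \<otimes>\<^bsub>R\<^esub> \<pi> [^]\<^bsub>R\<^esub> (m + m'))
    = x \<otimes>\<^bsub>K\<^esub> \<iota> (t \<otimes>\<^bsub>R\<^esub> t' \<otimes>\<^bsub>R\<^esub> \<pi> [^]\<^bsub>R\<^esub> (m + m')) \<oplus>\<^bsub>K\<^esub> y \<otimes>\<^bsub>K\<^esub> \<iota> (t' \<otimes>\<^bsub>R\<^esub> t \<otimes>\<^bsub>R\<^esub> \<pi> [^]\<^bsub>R\<^esub> (m' + m))"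
    using cl by (simp only: K.l_distr \<iota>.hom_closed R.m_closed R.nat_pow_closed \<pi>_carrier R.m_comm[of t' t] add.commute[of m' m])
  also have "\<dots> = \<iota> (u \<otimes>\<^bsub>R\<^esub> t' \<otimes>\<^bsub>R\<^esub> \<pi> [^]\<^bsub>R\<^esub> (l + m') \<oplus>\<^bsub>R\<^esub> u' \<otimes>\<^bsub>R\<^esub> t \<otimes>\<^bsub>R\<^esub> \<pi> [^]\<^bsub>R\<^esub> (l + m' + d))"
    using expansion_cross[OF assms(1) cl(6), of m'] expansion_cross[OF assms(2) cl(5), of m] cl assms(3)
    by simp
  also have "u \<otimes>\<^bsub>R\<^esub> t' \<otimes>\<^bsub>R\<^esub> \<pi> [^]\<^bsub>R\<^esub> (l + m') \<oplus>\<^bsub>R\<^esub> u' \<otimes>\<^bsub>R\<^esub> t \<otimes>\<^bsub>R\<^esub> \<pi> [^]\<^bsub>R\<^esub> (l + m' + d)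
    = (u \<otimes>\<^bsub>R\<^esub> t' \<oplus>\<^bsub>R\<^esub> u' \<otimes>\<^bsub>R\<^esub> t \<otimes>\<^bsub>R\<^esub> \<pi> [^]\<^bsub>R\<^esub> d) \<otimes>\<^bsub>R\<^esub> \<pi> [^]\<^bsub>R\<^esub> (l + m')"
    using cl by (simp add: R.l_distr R.r_distr R.nat_pow_mult[symmetric] R.m_ac)
  finally show ?thesis
    using cl assms by (simp add: expansion_def)
qed

lemma leading_term_add_less:
  assumes "leading_term x k q" "leading_term y k' q'" "k < k'"
  shows "leading_term (x \<oplus>\<^bsub>K\<^esub> y) k q"
proof -
  obtain u l t m u' l' t' m' where *: "expansion x u l t m" "q = \<phi> u" "k = int l - int m"
    "expansion y u' l' t' m'" "q' = \<phi> u'" "k' = int l' - int m'" "q \<noteq> \<zero>\<^bsub>F\<^esub>" "q' \<noteq> \<zero>\<^bsub>F\<^esub>"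
    using assms unfolding leading_term_def by metis
  then have cl: "u \<in> carrier R" "u' \<in> carrier R" "t \<in> carrier R" "t' \<in> carrier R"
    and one: "\<phi> t = \<one>\<^bsub>F\<^esub>" "\<phi> t' = \<one>\<^bsub>F\<^esub>"
    by (auto simp: expansion_def)
  define d where "d = l' + m - (l + m') - 1"
  have d: "l + m' + Suc d = l' + m"
    using * assms(3) by (simp add: d_def)
  have "\<phi> (u \<otimes>\<^bsub>R\<^esub> t' \<oplus>\<^bsub>R\<^esub> u' \<otimes>\<^bsub>R\<^esub> t \<otimes>\<^bsub>R\<^esub> \<pi> [^]\<^bsub>R\<^esub> Suc d) = q"
    using cl one * by simp
  moreover have "k = int (l + m') - int (m + m')"
    using * by simp
  ultimately show ?thesis
    using expansion_add[OF *(1,4) d] *(7) unfolding leading_term_def by blast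
qed

lemma leading_term_add_eq:
  assumes "leading_term x k q" "leading_term y k q'" "q \<oplus>\<^bsub>F\<^esub> q' \<noteq> \<zero>\<^bsub>F\<^esub>"
  shows "leading_term (x \<oplus>\<^bsub>K\<^esub> y) k (q \<oplus>\<^bsub>F\<^esub> q')"
proof -
  obtain u l t m u' l' t' m' where *: "expansion x u l t m" "q = \<phi> u" "k = int l - int m"
    "expansion y u' l' t' m'" "q' = \<phi> u'" "k = int l' - int m'" "q \<noteq> \<zero>\<^bsub>F\<^esub>" "q' \<noteq> \<zero>\<^bsub>F\<^esub>"
    using assms unfolding leading_term_def by metis
  then have cl: "u \<in> carrier R" "u' \<in> carrier R" "t \<in> carrier R" "t' \<in> carrier R"
    and one: "\<phi> t = \<one>\<^bsub>F\<^esub>" "\<phi> t' = \<one>\<^bsub>F\<^esub>"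
    by (auto simp: expansion_def)
  have d: "l + m' + 0 = l' + m"
    using * by simp
  have "\<phi> (u \<otimes>\<^bsub>R\<^esub> t' \<oplus>\<^bsub>R\<^esub> u' \<otimes>\<^bsub>R\<^esub> t \<otimes>\<^bsub>R\<^esub> \<pi> [^]\<^bsub>R\<^esub> (0::nat)) = q \<oplus>\<^bsub>F\<^esub> q'"
    using cl one * by simp
  moreover have "k = int (l + m') - int (m + m')"
    using * by simp
  ultimately show ?thesis
    using expansion_add[OF *(1,4) d] assms(3) unfolding leading_term_def by metis
qed

subsection \<open>Comparison with the ideal-theoretic valuation\<close>

abbreviation "\<pp> \<equiv> a_kernel R F \<phi>"
abbreviation \<pp>_power :: "nat \<Rightarrow> 'a set" where
  "\<pp>_power n \<equiv> \<pp> [^]\<^bsub>ideals_set R\<^esub> n"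

lemma kernel_iff: "x \<in> \<pp> \<longleftrightarrow> x \<in> carrier R \<and> \<phi> x = \<zero>\<^bsub>F\<^esub>"
  by (simp only: a_kernel_def' mem_Collect_eq)

lemma \<pp>_power_simps: "\<pp>_power 0 = carrier R" "\<pp>_power (Suc n) = ideal_prod R (\<pp>_power n) \<pp>"
  by (simp_all add: ideals_set_def)

lemma \<pp>_power_ideal: "ideal (\<pp>_power n) R"
proof (induction n)
  case 0
  then show ?case
    using R.oneideal by (simp only: \<pp>_power_simps)
next
  case (Suc n)
  then show ?case
    using R.ideal_prod_is_ideal[OF Suc \<phi>.ring.kernel_is_ideal] by (simp only: \<pp>_power_simps)
qed

text \<open>
  The elements that \<open>\<pi> ^ n\<close> divides after localization are closed under addition, and multiplying
  such an element by one of \<open>\<pp>\<close>, which \<open>\<pi>\<close> divides after localization, raises \<open>n\<close> by one.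
\<close>

lemma \<pp>_power_imp_\<pi>_power:
  "x \<in> \<pp>_power n \<Longrightarrow>
    \<exists>t\<in>carrier R. \<exists>r\<in>carrier R. \<phi> t = \<one>\<^bsub>F\<^esub> \<and> t \<otimes>\<^bsub>R\<^esub> x = r \<otimes>\<^bsub>R\<^esub> \<pi> [^]\<^bsub>R\<^esub> n"
proof (induction n arbitrary: x)
  case 0
  then have "x \<in> carrier R"
    by (simp only: \<pp>_power_simps)
  then show ?case
    by (intro bexI[of _ "\<one>\<^bsub>R\<^esub>"] bexI[of _ x]) simp_all
next
  case (Suc n)
  from Suc.prems have "x \<in> ideal_prod R (\<pp>_power n) \<pp>"
    by (simp only: \<pp>_power_simps)
  then show ?case
  proof (induction x rule: ideal_prod.induct)
    case (prod i j)
    obtain t r where t: "t \<in> carrier R" "r \<in> carrier R" "\<phi> t = \<one>\<^bsub>F\<^esub>"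
      "t \<otimes>\<^bsub>R\<^esub> i = r \<otimes>\<^bsub>R\<^esub> \<pi> [^]\<^bsub>R\<^esub> n"
      using Suc.IH prod by blast
    have i: "i \<in> carrier R"
      using prod(1) \<pp>_power_ideal ideal.Icarr by metis
    have j: "j \<in> carrier R" "\<phi> j = \<zero>\<^bsub>F\<^esub>"
      using prod(2) by (simp_all add: kernel_iff)
    obtain s b where s: "s \<in> carrier R" "b \<in> carrier R" "\<phi> s = \<one>\<^bsub>F\<^esub>"
      "s \<otimes>\<^bsub>R\<^esub> j = b \<otimes>\<^bsub>R\<^esub> \<pi>"
    proof (cases "j = \<zero>\<^bsub>R\<^esub>")
      case True
      then show ?thesis
        using that[of "\<one>\<^bsub>R\<^esub>" "\<zero>\<^bsub>R\<^esub>"] by simp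
    next
      case False
      then obtain s u k where s: "s \<in> carrier R" "u \<in> carrier R" "\<phi> s = \<one>\<^bsub>F\<^esub>" "\<phi> u \<noteq> \<zero>\<^bsub>F\<^esub>"
        "s \<otimes>\<^bsub>R\<^esub> j = u \<otimes>\<^bsub>R\<^esub> \<pi> [^]\<^bsub>R\<^esub> (k::nat)"
        using factorization[of j] j by auto
      have "k \<noteq> 0"
      proof
        assume "k = 0"
        then have "\<phi> (s \<otimes>\<^bsub>R\<^esub> j) = \<phi> u"
          using s by simp
        then show False
          using s(1,4) j by simp
      qed
      then obtain k' where "k = Suc k'"
        by (cases k) auto
      then show ?thesis
        using that[of s "u \<otimes>\<^bsub>R\<^esub> \<pi> [^]\<^bsub>R\<^esub> k'"] s by (simp add: R.m_assoc)
    qed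
    have "t \<otimes>\<^bsub>R\<^esub> s \<otimes>\<^bsub>R\<^esub> (i \<otimes>\<^bsub>R\<^esub> j) = (t \<otimes>\<^bsub>R\<^esub> i) \<otimes>\<^bsub>R\<^esub> (s \<otimes>\<^bsub>R\<^esub> j)"
      using t(1) s(1) i j(1) by (simp add: R.m_ac)
    also have "\<dots> = (r \<otimes>\<^bsub>R\<^esub> b) \<otimes>\<^bsub>R\<^esub> \<pi> [^]\<^bsub>R\<^esub> Suc n"
      unfolding t(4) s(4) using t(2) s(2) by (simp add: R.m_ac)
    finally show ?case
      using t(1-3) s(1-3) by (intro bexI[of _ "t \<otimes>\<^bsub>R\<^esub> s"] bexI[of _ "r \<otimes>\<^bsub>R\<^esub> b"]) auto
  next
    case (sum x y)
    then obtain t r s b where ts: "t \<in> carrier R" "r \<in> carrier R" "\<phi> t = \<one>\<^bsub>F\<^esub>"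
      "t \<otimes>\<^bsub>R\<^esub> x = r \<otimes>\<^bsub>R\<^esub> \<pi> [^]\<^bsub>R\<^esub> Suc n" "s \<in> carrier R" "b \<in> carrier R" "\<phi> s = \<one>\<^bsub>F\<^esub>"
      "s \<otimes>\<^bsub>R\<^esub> y = b \<otimes>\<^bsub>R\<^esub> \<pi> [^]\<^bsub>R\<^esub> Suc n"
      by blast
    have xy: "x \<in> carrier R" "y \<in> carrier R"
      using sum(1,2) R.ideal_prod_in_carrier[OF \<pp>_power_ideal \<phi>.ring.kernel_is_ideal] by auto
    have "t \<otimes>\<^bsub>R\<^esub> s \<otimes>\<^bsub>R\<^esub> (x \<oplus>\<^bsub>R\<^esub> y) = s \<otimes>\<^bsub>R\<^esub> (t \<otimes>\<^bsub>R\<^esub> x) \<oplus>\<^bsub>R\<^esub> t \<otimes>\<^bsub>R\<^esub> (s \<otimes>\<^bsub>R\<^esub> y)"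
      using ts(1,5) xy by (simp add: R.r_distr R.m_ac)
    also have "\<dots> = (s \<otimes>\<^bsub>R\<^esub> r \<oplus>\<^bsub>R\<^esub> t \<otimes>\<^bsub>R\<^esub> b) \<otimes>\<^bsub>R\<^esub> \<pi> [^]\<^bsub>R\<^esub> Suc n"
      unfolding ts(4,8) using ts(1,2,5,6) by (simp add: R.l_distr R.m_assoc)
    finally show ?case
      using ts(1-3,5-7) by (intro bexI[of _ "t \<otimes>\<^bsub>R\<^esub> s"] bexI[of _ "s \<otimes>\<^bsub>R\<^esub> r \<oplus>\<^bsub>R\<^esub> t \<otimes>\<^bsub>R\<^esub> b"]) auto
  qed
qed

lemma \<pi>_pow_in_\<pp>_power: "\<pi> [^]\<^bsub>R\<^esub> n \<in> \<pp>_power n"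
proof (induction n)
  case 0
  then show ?case
    unfolding \<pp>_power_simps by simp
next
  case (Suc n)
  moreover have "\<pi> \<in> \<pp>"
    by (simp add: kernel_iff)
  ultimately show ?case
    unfolding \<pp>_power_simps R.nat_pow_Suc by (rule ideal_prod.prod)
qed

text \<open>
  If \<open>t\<close> is 1 modulo \<open>\<pp>\<close>, then \<open>x = (1 - t) * x + t * x\<close> climbs from each power of \<open>\<pp>\<close> to the
  next, up to the power that contains \<open>t * x\<close>.
\<close>

lemma \<pp>_power_primary:
  assumes "t \<in> carrier R" "x \<in> carrier R" "\<phi> t = \<one>\<^bsub>F\<^esub>" "t \<otimes>\<^bsub>R\<^esub> x \<in> \<pp>_power n" "i \<le> n"
  shows "x \<in> \<pp>_power i"
  using assms(5)
proof (induction i)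
  case 0
  then show ?case
    using assms(2) by (simp only: \<pp>_power_simps)
next
  case (Suc i)
  then obtain d where "n = Suc i + d"
    by (metis le_Suc_ex)
  have "\<pp>_power (Suc i + e) \<subseteq> \<pp>_power (Suc i)" for e
  proof (induction e)
    case (Suc e)
    have "\<pp>_power (Suc (Suc i + e)) \<subseteq> \<pp>_power (Suc i + e)"
      using R.ideal_prod_inter[OF \<pp>_power_ideal \<phi>.ring.kernel_is_ideal]
      by (simp only: \<pp>_power_simps le_inf_iff)
    then show ?case
      using Suc by simp
  qed simp
  then have tx: "t \<otimes>\<^bsub>R\<^esub> x \<in> \<pp>_power (Suc i)"
    using assms(4) \<open>n = Suc i + d\<close> by blast
  have "\<one>\<^bsub>R\<^esub> \<ominus>\<^bsub>R\<^esub> t \<in> \<pp>"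
    using assms(1,3) by (simp add: kernel_iff a_minus_def F.r_neg)
  then have "x \<otimes>\<^bsub>R\<^esub> (\<one>\<^bsub>R\<^esub> \<ominus>\<^bsub>R\<^esub> t) \<in> \<pp>_power (Suc i)"
    unfolding \<pp>_power_simps using Suc by (intro ideal_prod.prod) simp_all
  moreover have "x = x \<otimes>\<^bsub>R\<^esub> (\<one>\<^bsub>R\<^esub> \<ominus>\<^bsub>R\<^esub> t) \<oplus>\<^bsub>R\<^esub> t \<otimes>\<^bsub>R\<^esub> x"
    using assms(1,2) by (simp add: a_minus_def R.r_distr R.r_minus R.m_comm[of t] R.a_assoc R.l_neg)
  ultimately show ?case
    using tx additive_subgroup.a_closed[OF ideal.axioms(1)[OF \<pp>_power_ideal]] by metis
qed

lemma ideal_ord_eq: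
  assumes t: "t \<in> carrier R" "u \<in> carrier R" "x \<in> carrier R" "\<phi> t = \<one>\<^bsub>F\<^esub>" "\<phi> u \<noteq> \<zero>\<^bsub>F\<^esub>"
    and eq: "t \<otimes>\<^bsub>R\<^esub> x = u \<otimes>\<^bsub>R\<^esub> \<pi> [^]\<^bsub>R\<^esub> (k::nat)"
  shows "ideal_ord R \<pp> x = k"
  unfolding ideal_ord_def
proof (rule Greatest_equality)
  have "t \<otimes>\<^bsub>R\<^esub> x \<in> \<pp>_power k"
    unfolding eq using \<pi>_pow_in_\<pp>_power ideal.I_l_closed[OF \<pp>_power_ideal] t(2) by metis
  then show "x \<in> \<pp>_power k"
    using \<pp>_power_primary t by blast
next
  fix n assume "x \<in> \<pp>_power n"
  then obtain s r where s: "s \<in> carrier R" "r \<in> carrier R" "\<phi> s = \<one>\<^bsub>F\<^esub>"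
    "s \<otimes>\<^bsub>R\<^esub> x = r \<otimes>\<^bsub>R\<^esub> \<pi> [^]\<^bsub>R\<^esub> n"
    using \<pp>_power_imp_\<pi>_power by blast
  have "(s \<otimes>\<^bsub>R\<^esub> u) \<otimes>\<^bsub>R\<^esub> \<pi> [^]\<^bsub>R\<^esub> k = s \<otimes>\<^bsub>R\<^esub> (t \<otimes>\<^bsub>R\<^esub> x)"
    unfolding eq using s(1) t by (simp add: R.m_assoc)
  also have "\<dots> = t \<otimes>\<^bsub>R\<^esub> (s \<otimes>\<^bsub>R\<^esub> x)"
    using s(1) t by (simp add: R.m_ac)
  also have "\<dots> = (t \<otimes>\<^bsub>R\<^esub> r) \<otimes>\<^bsub>R\<^esub> \<pi> [^]\<^bsub>R\<^esub> n"
    unfolding s(4) using s(2) t by (simp add: R.m_assoc)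
  finally show "n \<le> k"
    using unit_part_unique_le[of "s \<otimes>\<^bsub>R\<^esub> u" "t \<otimes>\<^bsub>R\<^esub> r" k n] s t by fastforce
qed

lemma leading_term_ideal_ord:
  assumes "x \<in> carrier R - {\<zero>\<^bsub>R\<^esub>}"
  shows "\<exists>q. leading_term (\<iota> x) (int (ideal_ord R \<pp> x)) q"
  using factorization[OF assms] assms leading_term_embed ideal_ord_eq by (metis DiffD1)

lemma adic_val_eq:
  assumes "leading_term x k q"
  shows "adic_val R K \<iota> \<pp> x = k"
proof -
  have x: "x \<in> carrier K - {\<zero>\<^bsub>K\<^esub>}"
    using leading_term_nonzero[OF assms] .
  have *: "int (ideal_ord R \<pp> u) - int (ideal_ord R \<pp> w) = k"
    if u: "u \<in> carrier R - {\<zero>\<^bsub>R\<^esub>}" and w: "w \<in> carrier R - {\<zero>\<^bsub>R\<^esub>}"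
      and xuw: "x = \<iota> u \<otimes>\<^bsub>K\<^esub> inv\<^bsub>K\<^esub> (\<iota> w)" for u w
  proof -
    have "inv\<^bsub>K\<^esub> (\<iota> w) \<in> carrier K" "inv\<^bsub>K\<^esub> (\<iota> w) \<otimes>\<^bsub>K\<^esub> \<iota> w = \<one>\<^bsub>K\<^esub>"
      using embed_nonzero[OF w] K.field_Units K.Units_inv_closed K.Units_l_inv by auto
    then have xw: "x \<otimes>\<^bsub>K\<^esub> \<iota> w = \<iota> u"
      using u w by (simp add: xuw K.m_assoc)
    obtain q1 q2 where q: "leading_term (\<iota> u) (int (ideal_ord R \<pp> u)) q1"
      "leading_term (\<iota> w) (int (ideal_ord R \<pp> w)) q2"
      using leading_term_ideal_ord u w by blast
    have "k + int (ideal_ord R \<pp> w) = int (ideal_ord R \<pp> u)"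
      using leading_term_unique[OF leading_term_mult[OF assms q(2), unfolded xw] q(1)] by simp
    then show ?thesis
      by simp
  qed
  obtain u w where uw: "u \<in> carrier R" "w \<in> carrier R - {\<zero>\<^bsub>R\<^esub>}" "x = \<iota> u \<otimes>\<^bsub>K\<^esub> inv\<^bsub>K\<^esub> (\<iota> w)"
    using embed_quotients x by blast
  moreover have "inv\<^bsub>K\<^esub> (\<iota> w) \<in> carrier K"
    using embed_nonzero[OF uw(2)] K.field_Units by auto
  ultimately have u: "u \<in> carrier R - {\<zero>\<^bsub>R\<^esub>}"
    using x by auto
  show ?thesis
    unfolding adic_val_def
  proof (rule the_equality)
    show "\<exists>u\<in>carrier R - {\<zero>\<^bsub>R\<^esub>}. \<exists>w\<in>carrier R - {\<zero>\<^bsub>R\<^esub>}.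
        x = \<iota> u \<otimes>\<^bsub>K\<^esub> inv\<^bsub>K\<^esub> \<iota> w \<and> k = int (ideal_ord R \<pp> u) - int (ideal_ord R \<pp> w)"
      using u uw * by blast
  qed (use * in blast)
qed

definition leading_coeff :: "'k \<Rightarrow> 'f" where
  "leading_coeff x = (THE q. \<exists>k. leading_term x k q)"

lemma leading_coeff_eq: "leading_term x k q \<Longrightarrow> leading_coeff x = q"
  unfolding leading_coeff_def using leading_term_unique by blast

lemma leading_term_canonical:
  assumes "x \<in> carrier K - {\<zero>\<^bsub>K\<^esub>}"
  shows "leading_term x (adic_val R K \<iota> \<pp> x) (leading_coeff x)"
  using leading_term_exists[OF assms] adic_val_eq leading_coeff_eq by metis

lemma leading_coeff_angular_component:
  "angular_component K F (adic_val R K \<iota> \<pp>) leading_coeff"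
proof unfold_locales
  fix x assume x: "x \<in> carrier K - {\<zero>\<^bsub>K\<^esub>}"
  show "leading_coeff x \<in> carrier F - {\<zero>\<^bsub>F\<^esub>}"
    using leading_term_canonical[OF x] by (auto simp: leading_term_def expansion_def)
  fix y assume y: "y \<in> carrier K - {\<zero>\<^bsub>K\<^esub>}"
  note lx = leading_term_canonical[OF x] and ly = leading_term_canonical[OF y]
  note mult = leading_term_mult[OF lx ly]
  show "adic_val R K \<iota> \<pp> (x \<otimes>\<^bsub>K\<^esub> y) = adic_val R K \<iota> \<pp> x + adic_val R K \<iota> \<pp> y"
    by (rule adic_val_eq[OF mult])
  show "leading_coeff (x \<otimes>\<^bsub>K\<^esub> y) = leading_coeff x \<otimes>\<^bsub>F\<^esub> leading_coeff y"
    by (rule leading_coeff_eq[OF mult])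
  note less = leading_term_add_less[OF lx ly]
  show "adic_val R K \<iota> \<pp> (x \<oplus>\<^bsub>K\<^esub> y) = adic_val R K \<iota> \<pp> x"
    "leading_coeff (x \<oplus>\<^bsub>K\<^esub> y) = leading_coeff x"
    if "adic_val R K \<iota> \<pp> x < adic_val R K \<iota> \<pp> y"
    by (rule adic_val_eq[OF less[OF that]], rule leading_coeff_eq[OF less[OF that]])
  show "leading_coeff (x \<oplus>\<^bsub>K\<^esub> y) = leading_coeff x \<oplus>\<^bsub>F\<^esub> leading_coeff y"
    if "adic_val R K \<iota> \<pp> x = adic_val R K \<iota> \<pp> y" "leading_coeff x \<oplus>\<^bsub>F\<^esub> leading_coeff y \<noteq> \<zero>\<^bsub>F\<^esub>"
    by (rule leading_coeff_eq[OF leading_term_add_eq[OF lx ly[folded that(1)] that(2)]])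
qed

lemma unit_leading_term:
  assumes "x \<in> carrier R" "\<phi> x \<noteq> \<zero>\<^bsub>F\<^esub>"
  shows "adic_val R K \<iota> \<pp> (\<iota> x) = 0" "leading_coeff (\<iota> x) = \<phi> x"
proof -
  have *: "leading_term (\<iota> x) (int 0) (\<phi> x)"
    using leading_term_embed[of "\<one>\<^bsub>R\<^esub>" x x 0] assms by simp
  show "adic_val R K \<iota> \<pp> (\<iota> x) = 0" "leading_coeff (\<iota> x) = \<phi> x"
    using adic_val_eq[OF *] leading_coeff_eq[OF *] by simp_all
qed

end

section \<open>Spans of powers and monic relations\<close>

context ring
begin

text \<open>
  The values at \<open>x\<close> of polynomials of degree less than \<open>k\<close>, that is, the \<open>A\<close>-module spanned by
  the first \<open>k\<close> powers of \<open>x\<close>. Coefficient lists of exact length \<open>k\<close>, possibly with leading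
  zeros, make it satisfy the recursion \<open>poly_span_Suc\<close>.
\<close>

definition poly_span :: "'a set \<Rightarrow> 'a \<Rightarrow> nat \<Rightarrow> 'a set" where
  "poly_span A x k = {eval f x | f. length f = k \<and> set f \<subseteq> A}"

lemma poly_span_0: "poly_span A x 0 = {\<zero>}"
  by (auto simp: poly_span_def)

lemma poly_span_Suc:
  "poly_span A x (Suc k) = {a \<otimes> x [^] k \<oplus> y | a y. a \<in> A \<and> y \<in> poly_span A x k}"
  (is "?L = ?R")
proof
  show "?L \<subseteq> ?R"
    by (fastforce simp: poly_span_def length_Suc_conv)
  show "?R \<subseteq> ?L"
  proof
    fix z assume "z \<in> ?R"
    then obtain a f where "a \<in> A" "length f = k" "set f \<subseteq> A" "z = a \<otimes> x [^] k \<oplus> eval f x"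
      by (auto simp: poly_span_def)
    then show "z \<in> ?L"
      unfolding poly_span_def by (intro CollectI exI[of _ "a # f"]) auto
  qed
qed

lemma poly_span_carrier:
  assumes "A \<subseteq> carrier R" "x \<in> carrier R"
  shows "poly_span A x k \<subseteq> carrier R"
  using assms eval_in_carrier by (auto simp: poly_span_def)

end

context cring
begin

lemma poly_span_add:
  assumes A: "subring A R" and x: "x \<in> carrier R"
  shows "y \<in> poly_span A x k \<Longrightarrow> z \<in> poly_span A x k \<Longrightarrow> y \<oplus> z \<in> poly_span A x k"
proof (induction k arbitrary: y z)
  case 0
  then show ?case
    by (simp add: poly_span_0)
next
  case (Suc k)
  then obtain a b y' z' where *: "a \<in> A" "b \<in> A" "y' \<in> poly_span A x k" "z' \<in> poly_span A x k"
    "y = a \<otimes> x [^] k \<oplus> y'" "z = b \<otimes> x [^] k \<oplus> z'"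
    by (auto simp: poly_span_Suc)
  have cl: "a \<in> carrier R" "b \<in> carrier R" "y' \<in> carrier R" "z' \<in> carrier R"
    using * subringE(1)[OF A] poly_span_carrier[OF subringE(1)[OF A] x] by auto
  have "y \<oplus> z = (a \<oplus> b) \<otimes> x [^] k \<oplus> (y' \<oplus> z')"
    using cl x *(5,6) by (simp add: l_distr a_ac)
  moreover have "a \<oplus> b \<in> A" "y' \<oplus> z' \<in> poly_span A x k"
    using * Suc.IH subringE(7)[OF A] by auto
  ultimately show ?case
    unfolding poly_span_Suc by blast
qed

lemma poly_span_smult:
  assumes A: "subring A R" and x: "x \<in> carrier R" and b: "b \<in> A"
  shows "y \<in> poly_span A x k \<Longrightarrow> b \<otimes> y \<in> poly_span A x k"
proof (induction k arbitrary: y)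
  case 0
  then show ?case
    using b subringE(1)[OF A] by (auto simp: poly_span_0)
next
  case (Suc k)
  then obtain a y' where *: "a \<in> A" "y' \<in> poly_span A x k" "y = a \<otimes> x [^] k \<oplus> y'"
    by (auto simp: poly_span_Suc)
  have cl: "a \<in> carrier R" "b \<in> carrier R" "y' \<in> carrier R"
    using * b subringE(1)[OF A] poly_span_carrier[OF subringE(1)[OF A] x] by auto
  have "b \<otimes> y = (b \<otimes> a) \<otimes> x [^] k \<oplus> b \<otimes> y'"
    using cl x *(3) by (simp add: r_distr m_assoc)
  moreover have "b \<otimes> a \<in> A" "b \<otimes> y' \<in> poly_span A x k"
    using * b Suc.IH subringE(6)[OF A] by auto
  ultimately show ?case
    unfolding poly_span_Suc by blast
qed

lemma poly_span_mono_Suc: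
  assumes A: "subring A R" and x: "x \<in> carrier R"
  shows "poly_span A x k \<subseteq> poly_span A x (Suc k)"
proof
  fix y assume y: "y \<in> poly_span A x k"
  then have "y \<in> carrier R"
    using poly_span_carrier[OF subringE(1)[OF A] x] by blast
  then have "y = \<zero> \<otimes> x [^] k \<oplus> y"
    using x by simp
  then show "y \<in> poly_span A x (Suc k)"
    unfolding poly_span_Suc using y subringE(2)[OF A] by blast
qed

lemma zero_in_poly_span:
  assumes A: "subring A R" and x: "x \<in> carrier R"
  shows "\<zero> \<in> poly_span A x k"
  by (induction k) (use poly_span_0 poly_span_mono_Suc[OF A x] in blast)+

lemma power_in_poly_span:
  assumes A: "subring A R" and x: "x \<in> carrier R"
  shows "x [^] k \<in> poly_span A x (Suc k)"
proof -
  have "x [^] k = \<one> \<otimes> x [^] k \<oplus> \<zero>"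
    using x by simp
  then show ?thesis
    unfolding poly_span_Suc using zero_in_poly_span[OF A x] subringE(3)[OF A] by blast
qed

lemma power_dependent_imp_monic_root:
  assumes A: "subring A R" and x: "x \<in> carrier R" and "\<one> \<noteq> \<zero>"
    and dep: "x [^] k \<in> poly_span A x k"
  shows "\<exists>f. f \<in> carrier (univ_poly R A) \<and> f \<noteq> [] \<and> lead_coeff f = \<one> \<and> eval f x = \<zero>"
proof -
  have "\<ominus> \<one> \<in> A"
    using subringE(3,5)[OF A] by simp
  then have "\<ominus> \<one> \<otimes> x [^] k \<in> poly_span A x k"
    using poly_span_smult[OF A x _ dep] by simp
  then obtain f where f: "\<ominus> (x [^] k) = eval f x" "length f = k" "set f \<subseteq> A"
    using x by (auto simp: poly_span_def l_minus)
  have "eval (\<one> # f) x = x [^] k \<oplus> \<ominus> (x [^] k)"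
    using x f(2) by (simp add: f(1)[symmetric])
  also have "\<dots> = \<zero>"
    using x by (simp add: r_neg)
  finally have "eval (\<one> # f) x = \<zero>" .
  moreover have "\<one> # f \<in> carrier (univ_poly R A)"
    using f(3) subringE(3)[OF A] \<open>\<one> \<noteq> \<zero>\<close> by (simp add: univ_poly_def polynomial_def)
  ultimately show ?thesis
    by (intro exI[of _ "\<one> # f"]) simp
qed

end

section \<open>Uniformizers in Dedekind domains\<close>

context cring
begin

definition colon_ideal :: "'a \<Rightarrow> 'a \<Rightarrow> 'a set" where
  "colon_ideal \<alpha> \<beta> = {r \<in> carrier R. \<exists>s\<in>carrier R. \<beta> \<otimes> r = \<alpha> \<otimes> s}"

lemma ideal_subsetI:
  assumes "I \<subseteq> carrier R" "\<zero> \<in> I"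
    and "\<And>x y. x \<in> I \<Longrightarrow> y \<in> I \<Longrightarrow> x \<oplus> y \<in> I"
    and "\<And>x r. x \<in> I \<Longrightarrow> r \<in> carrier R \<Longrightarrow> x \<otimes> r \<in> I"
  shows "ideal I R"
proof (rule idealI)
  show "subgroup I (add_monoid R)"
  proof (rule add.subgroupI)
    show "\<ominus> x \<in> I" if "x \<in> I" for x
      using assms(4)[OF that, of "\<ominus> \<one>"] that assms(1) by (auto simp: r_minus)
  qed (use assms in auto)
  show "x \<otimes> r \<in> I" if "x \<in> I" "r \<in> carrier R" for x r
    using assms(4) that .
  then show "r \<otimes> x \<in> I" if "x \<in> I" "r \<in> carrier R" for x r
    using that assms(1) m_comm[of r x] by auto
qed (rule ring_axioms)

lemma colon_ideal_is_ideal: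
  assumes "\<alpha> \<in> carrier R" "\<beta> \<in> carrier R"
  shows "ideal (colon_ideal \<alpha> \<beta>) R"
proof (rule ideal_subsetI)
  show "\<zero> \<in> colon_ideal \<alpha> \<beta>"
    using assms by (auto simp: colon_ideal_def intro: bexI[of _ \<zero>])
  fix x assume x: "x \<in> colon_ideal \<alpha> \<beta>"
  then obtain s where s: "x \<in> carrier R" "s \<in> carrier R" "\<beta> \<otimes> x = \<alpha> \<otimes> s"
    by (auto simp: colon_ideal_def)
  show "x \<oplus> y \<in> colon_ideal \<alpha> \<beta>" if y: "y \<in> colon_ideal \<alpha> \<beta>" for y
  proof -
    obtain t where t: "y \<in> carrier R" "t \<in> carrier R" "\<beta> \<otimes> y = \<alpha> \<otimes> t"
      using y by (auto simp: colon_ideal_def)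
    have "\<beta> \<otimes> (x \<oplus> y) = \<alpha> \<otimes> (s \<oplus> t)"
      using assms s t by (simp add: r_distr)
    then show ?thesis
      using s t by (auto simp: colon_ideal_def)
  qed
  show "x \<otimes> r \<in> colon_ideal \<alpha> \<beta>" if "r \<in> carrier R" for r
  proof -
    have "\<beta> \<otimes> (x \<otimes> r) = \<alpha> \<otimes> (s \<otimes> r)"
      using assms s that by (simp add: m_assoc[symmetric])
    then show ?thesis
      using s that by (auto simp: colon_ideal_def)
  qed
qed (auto simp: colon_ideal_def)

end

lemma (in noetherian_ring) maximal_ideal_in_family:
  assumes "\<A> \<noteq> {}" "\<And>I. I \<in> \<A> \<Longrightarrow> ideal I R"
  obtains I where "I \<in> \<A>" "\<And>J. J \<in> \<A> \<Longrightarrow> I \<subseteq> J \<Longrightarrow> J = I"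
proof -
  have "\<exists>M\<in>\<A>. \<forall>J\<in>\<A>. M \<subseteq> J \<longrightarrow> J = M"
  proof (rule subset_Zorn_nonempty[OF assms(1)])
    fix C assume C: "C \<noteq> {}" "subset.chain \<A> C"
    then have "subset.chain {I. ideal I R} C"
      using assms(2) by (auto simp: pred_on.chain_def)
    then have "\<Union>C \<in> C"
      using ideal_chain_is_trivial C(1) by blast
    then show "\<Union>C \<in> \<A>"
      using C(2) by (auto simp: pred_on.chain_def)
  qed
  then show thesis
    using that by blast
qed

text \<open>
  A maximal member \<open>(\<alpha> : \<beta>)\<close> of the family of colon ideals contained in \<open>\<pp>\<close> is prime, by the
  usual argument for associated primes: the colon ideal of a multiple \<open>\<beta> * x\<close> contains
  that of \<open>\<beta>\<close>, so by maximality it is equal to it or not contained in \<open>\<pp>\<close>. As nonzero primes are maximal, the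
  member is \<open>\<pp>\<close> itself. Restricting the family to ideals inside \<open>\<pp>\<close> plays the role of localizing
  at \<open>\<pp>\<close>.
\<close>

lemma (in noetherian_domain) prime_is_colon_ideal:
  assumes p: "primeideal \<pp> R" and \<alpha>: "\<alpha> \<in> \<pp>" "\<alpha> \<noteq> \<zero>"
    and dim: "\<And>q. primeideal q R \<Longrightarrow> q \<noteq> {\<zero>} \<Longrightarrow> maximalideal q R"
  obtains \<beta> where "\<beta> \<in> carrier R" "colon_ideal \<alpha> \<beta> = \<pp>"
proof -
  interpret p: primeideal \<pp> R
    by (rule p)
  have \<alpha>R: "\<alpha> \<in> carrier R"
    using \<alpha>(1) p.Icarr by blast
  define \<A> where "\<A> = {colon_ideal \<alpha> \<beta> | \<beta>. \<beta> \<in> carrier R \<and> colon_ideal \<alpha> \<beta> \<subseteq> \<pp>}"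
  have "colon_ideal \<alpha> \<one> \<subseteq> \<pp>"
    using \<alpha>(1) p.I_r_closed by (auto simp: colon_ideal_def)
  then have "\<A> \<noteq> {}"
    using \<A>_def one_closed by blast
  moreover have "ideal I R" if "I \<in> \<A>" for I
    using that colon_ideal_is_ideal[OF \<alpha>R] by (auto simp: \<A>_def)
  ultimately obtain I where I: "I \<in> \<A>" and max: "\<And>J. J \<in> \<A> \<Longrightarrow> I \<subseteq> J \<Longrightarrow> J = I"
    using maximal_ideal_in_family by metis
  then obtain \<beta> where \<beta>: "\<beta> \<in> carrier R" "I = colon_ideal \<alpha> \<beta>" "I \<subseteq> \<pp>"
    by (auto simp: \<A>_def)
  have mono: "I \<subseteq> colon_ideal \<alpha> (\<beta> \<otimes> x)" if "x \<in> carrier R" for x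
  proof
    fix r assume "r \<in> I"
    then obtain s where s: "r \<in> carrier R" "s \<in> carrier R" "\<beta> \<otimes> r = \<alpha> \<otimes> s"
      by (auto simp: \<beta> colon_ideal_def)
    have "\<beta> \<otimes> x \<otimes> r = x \<otimes> (\<beta> \<otimes> r)"
      using \<beta>(1) that s(1) by (simp add: m_ac)
    also have "\<dots> = \<alpha> \<otimes> (x \<otimes> s)"
      unfolding s(3) using \<alpha>R that s(2) by (simp add: m_ac)
    finally show "r \<in> colon_ideal \<alpha> (\<beta> \<otimes> x)"
      using s(1,2) that by (auto simp: colon_ideal_def)
  qed
  have colon_swap: "y \<in> colon_ideal \<alpha> (\<beta> \<otimes> x) \<longleftrightarrow> x \<otimes> y \<in> I" if "x \<in> carrier R" "y \<in> carrier R" for x y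
    using that \<beta>(1) by (simp add: \<beta>(2) colon_ideal_def m_assoc)
  have same: "colon_ideal \<alpha> (\<beta> \<otimes> x) = I" if "x \<in> carrier R" "colon_ideal \<alpha> (\<beta> \<otimes> x) \<subseteq> \<pp>" for x
    using that mono \<beta>(1) by (intro max) (auto simp: \<A>_def)
  have "primeideal I R"
  proof (rule primeidealI)
    show "ideal I R"
      using \<beta> colon_ideal_is_ideal \<alpha>R by simp
    show "carrier R \<noteq> I"
      using \<beta>(3) p.I_notcarr p.a_subset by auto
    show "x \<in> I \<or> y \<in> I" if xy: "x \<in> carrier R" "y \<in> carrier R" "x \<otimes> y \<in> I" for x y
    proof (cases "colon_ideal \<alpha> (\<beta> \<otimes> x) \<subseteq> \<pp>")
      case True
      then show ?thesis
        using same colon_swap xy by blast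
    next
      case False
      then obtain t where t: "t \<in> carrier R" "t \<notin> \<pp>" "x \<otimes> t \<in> I"
        using colon_swap xy(1) by (auto simp: colon_ideal_def)
      \<comment> \<open>Multiplying \<open>\<beta>\<close> by an element outside the prime \<open>\<pp>\<close> cannot take the colon ideal out of
        \<open>\<pp>\<close>.\<close>
      have "colon_ideal \<alpha> (\<beta> \<otimes> t) \<subseteq> \<pp>"
      proof
        fix u assume u: "u \<in> colon_ideal \<alpha> (\<beta> \<otimes> t)"
        then have uR: "u \<in> carrier R"
          by (simp add: colon_ideal_def)
        then have "t \<otimes> u \<in> \<pp>"
          using colon_swap[OF t(1) uR] u \<beta>(3) by blast
        then show "u \<in> \<pp>"
          using p.I_prime t uR by blast
      qed
      then have "x \<in> I"
        using same[OF t(1)] colon_swap[OF t(1) xy(1)] t(3) m_comm[OF t(1) xy(1)] by simp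
      then show ?thesis ..
    qed
  qed (rule cring_axioms)
  moreover have "\<alpha> \<in> I"
    using \<alpha>R \<beta> m_comm by (auto simp: colon_ideal_def)
  then have "I \<noteq> {\<zero>}"
    using \<alpha>(2) by auto
  ultimately interpret I: maximalideal I R
    by (rule dim)
  have "I = \<pp>"
    using I.I_maximal[OF p.is_ideal \<beta>(3)] p.a_subset p.I_notcarr by auto
  then show thesis
    using that \<beta> by blast
qed

text \<open>
  As long as \<open>x\<close> lies in \<open>\<pp>\<close>, the hypothesis \<open>div\<close> splits off one factor \<open>\<pi>\<close>. The process stops
  because \<open>R\<close> is noetherian: among the elements without a factorization take one whose ideal \<open>J x\<close>,
  the contraction of the principal ideal that \<open>x\<close> generates in the localization at \<open>\<pp>\<close>, is maximal.
  The cofactor of \<open>\<pi>\<close> has no factorization either, and its ideal is strictly larger because \<open>\<pi>\<close>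
  is not a unit in the localization.
\<close>

lemma (in noetherian_domain) uniformizer_factorization:
  assumes p: "primeideal \<pp> R" and \<pi>: "\<pi> \<in> \<pp>" and s: "s \<in> carrier R" "s \<notin> \<pp>"
    and div: "\<And>x. x \<in> \<pp> \<Longrightarrow> \<exists>r\<in>carrier R. s \<otimes> x = r \<otimes> \<pi>"
    and x: "x \<in> carrier R" "x \<noteq> \<zero>"
  shows "\<exists>t\<in>carrier R - \<pp>. \<exists>u\<in>carrier R - \<pp>. \<exists>k::nat. t \<otimes> x = u \<otimes> \<pi> [^] k"
proof (rule ccontr)
  interpret p: primeideal \<pp> R
    by (rule p)
  have p_mult: "a \<otimes> b \<in> carrier R - \<pp>" if "a \<in> carrier R - \<pp>" "b \<in> carrier R - \<pp>" for a b
    using that p.I_prime[of a b] by auto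
  have one: "\<one> \<in> carrier R - \<pp>"
    using p.one_imp_carrier p.I_notcarr by auto
  have \<pi>R: "\<pi> \<in> carrier R"
    using \<pi> p.Icarr by blast
  let ?P = "\<lambda>x. \<exists>t\<in>carrier R - \<pp>. \<exists>u\<in>carrier R - \<pp>. \<exists>k::nat. t \<otimes> x = u \<otimes> \<pi> [^] k"
  define J where "J x = {y \<in> carrier R. \<exists>t\<in>carrier R - \<pp>. \<exists>r\<in>carrier R. t \<otimes> y = x \<otimes> r}" for x
  have J_ideal: "ideal (J x) R" if x: "x \<in> carrier R" for x
  proof (rule ideal_subsetI)
    show "\<zero> \<in> J x"
      using one x by (auto simp: J_def intro!: bexI[of _ \<one>] bexI[of _ \<zero>])
    fix y assume "y \<in> J x"
    then obtain t r where t: "y \<in> carrier R" "t \<in> carrier R - \<pp>" "r \<in> carrier R" "t \<otimes> y = x \<otimes> r"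
      by (auto simp: J_def)
    show "y \<oplus> z \<in> J x" if z: "z \<in> J x" for z
    proof -
      obtain t' r' where t': "z \<in> carrier R" "t' \<in> carrier R - \<pp>" "r' \<in> carrier R" "t' \<otimes> z = x \<otimes> r'"
        using z by (auto simp: J_def)
      have "t \<otimes> t' \<otimes> (y \<oplus> z) = t' \<otimes> (t \<otimes> y) \<oplus> t \<otimes> (t' \<otimes> z)"
        using t(1,2) t'(1,2) by (simp add: r_distr m_ac)
      also have "\<dots> = x \<otimes> (t' \<otimes> r \<oplus> t \<otimes> r')"
        unfolding t(4) t'(4) using x t(1-3) t'(1-3) by (simp add: r_distr m_ac)
      finally show ?thesis
        using p_mult[OF t(2) t'(2)] t(1-3) t'(1-3) unfolding J_def by blast
    qed
    show "y \<otimes> z \<in> J x" if "z \<in> carrier R" for z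
    proof -
      have "t \<otimes> (y \<otimes> z) = x \<otimes> (r \<otimes> z)"
        using x t that by (simp add: m_assoc[symmetric])
      then show ?thesis
        using t that unfolding J_def by blast
    qed
  qed (auto simp: J_def)
  assume "\<not> ?P x"
  define bad where "bad = {x \<in> carrier R - {\<zero>}. \<not> ?P x}"
  have "J ` bad \<noteq> {}"
    using x \<open>\<not> ?P x\<close> by (auto simp: bad_def)
  moreover have "ideal I R" if "I \<in> J ` bad" for I
    using that J_ideal by (auto simp: bad_def)
  ultimately obtain I where I: "I \<in> J ` bad" and max: "\<And>I'. I' \<in> J ` bad \<Longrightarrow> I \<subseteq> I' \<Longrightarrow> I' = I"
    using maximal_ideal_in_family by metis
  then obtain y where y: "y \<in> bad" "I = J y"
    by blast
  then have yR: "y \<in> carrier R" "y \<noteq> \<zero>" "\<not> ?P y"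
    by (auto simp: bad_def)
  have "y \<in> \<pp>"
  proof (rule ccontr)
    assume "y \<notin> \<pp>"
    then have "\<one> \<otimes> y = y \<otimes> \<pi> [^] (0::nat)" "y \<in> carrier R - \<pp>"
      using yR by auto
    then show False
      using yR(3) one by blast
  qed
  then obtain r where r: "r \<in> carrier R" "s \<otimes> y = r \<otimes> \<pi>"
    using div by blast
  have "s \<noteq> \<zero>"
    using s(2) p.zero_closed by blast
  then have "s \<otimes> y \<noteq> \<zero>"
    using s(1) yR by (simp add: integral_iff)
  then have "r \<noteq> \<zero>"
    using r \<pi>R by auto
  have "\<not> ?P r"
  proof
    assume "?P r"
    then obtain t u k where t: "t \<in> carrier R - \<pp>" "u \<in> carrier R - \<pp>" "t \<otimes> r = u \<otimes> \<pi> [^] (k::nat)"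
      by blast
    have "t \<otimes> s \<otimes> y = t \<otimes> r \<otimes> \<pi>"
      using t(1) s yR(1) r \<pi>R by (simp add: m_assoc)
    also have "\<dots> = u \<otimes> \<pi> [^] Suc k"
      unfolding t(3) using t(2) \<pi>R by (simp add: m_assoc)
    finally show False
      using yR(3) p_mult[of t s] t(1,2) s by blast
  qed
  then have "J r \<in> J ` bad"
    using r(1) \<open>r \<noteq> \<zero>\<close> by (auto simp: bad_def)
  moreover have "I \<subseteq> J r"
  proof
    fix z assume "z \<in> I"
    then obtain t v where t: "z \<in> carrier R" "t \<in> carrier R - \<pp>" "v \<in> carrier R" "t \<otimes> z = y \<otimes> v"
      by (auto simp: y J_def)
    have "s \<otimes> t \<otimes> z = (s \<otimes> y) \<otimes> v"
      using s(1) t yR(1) by (simp add: m_assoc)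
    also have "\<dots> = r \<otimes> (\<pi> \<otimes> v)"
      unfolding r(2) using r(1) \<pi>R t(3) by (simp add: m_assoc)
    finally show "z \<in> J r"
      using p_mult[of s t] s t(1-3) \<pi>R unfolding J_def by blast
  qed
  ultimately have "J r = J y"
    using max y(2) by simp
  moreover have "r \<in> J r"
    using r(1) one unfolding J_def by (auto intro!: bexI[of _ \<one>])
  ultimately obtain t v where t: "t \<in> carrier R - \<pp>" "v \<in> carrier R" "t \<otimes> r = y \<otimes> v"
    by (auto simp: J_def)
  have "r \<otimes> (s \<otimes> t) = s \<otimes> (t \<otimes> r)"
    using r(1) s(1) t(1) by (simp add: m_ac)
  also have "\<dots> = (s \<otimes> y) \<otimes> v"
    unfolding t(3) using s(1) yR(1) t(2) by (simp add: m_assoc)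
  also have "\<dots> = r \<otimes> (v \<otimes> \<pi>)"
    unfolding r(2) using r(1) \<pi>R t(2) by (simp add: m_ac)
  finally have "s \<otimes> t = v \<otimes> \<pi>"
    using m_lcancel[OF \<open>r \<noteq> \<zero>\<close>] r(1) s(1) t(1,2) \<pi>R by auto
  moreover have "v \<otimes> \<pi> \<in> \<pp>"
    using \<pi> t(2) p.I_l_closed by blast
  ultimately show False
    using p_mult[of s t] s t(1) by auto
qed

lemma (in ideal) coset_eq_zero_iff:
  assumes "x \<in> carrier R"
  shows "I +> x = \<zero>\<^bsub>R Quot I\<^esub> \<longleftrightarrow> x \<in> I"
proof -
  have "\<zero>\<^bsub>R Quot I\<^esub> = I"
    by (simp add: FactRing_def)
  then show ?thesis
    using assms rcos_const_imp_mem a_rcos_zero[OF is_ideal] by metis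
qed

context dedekind_domain
begin

sublocale \<iota>: ring_hom_cring R K \<iota>
  by (intro ring_hom_cring.intro ring_hom_cring_axioms.intro R.is_cring K.is_cring embed_hom)

text \<open>
  The elements of \<open>R\<close> of the form \<open>\<alpha> * y\<close>, with \<open>y\<close> in the span of the first \<open>k\<close> powers of
  \<open>\<gamma>\<close>, form an increasing sequence of ideals. Where it becomes stationary, \<open>\<alpha> * \<gamma> ^ k\<close> is
  \<open>\<alpha>\<close> times a combination of lower powers of \<open>\<gamma>\<close>, so \<open>\<gamma>\<close> is integral over \<open>R\<close>.
\<close>

lemma fractional_powers_imp_integral:
  assumes \<gamma>: "\<gamma> \<in> carrier K" and \<alpha>: "\<alpha> \<in> carrier R" "\<alpha> \<noteq> \<zero>\<^bsub>R\<^esub>"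
    and pow: "\<And>k::nat. \<iota> \<alpha> \<otimes>\<^bsub>K\<^esub> \<gamma> [^]\<^bsub>K\<^esub> k \<in> \<iota> ` carrier R"
  shows "\<gamma> \<in> \<iota> ` carrier R"
proof -
  let ?A = "\<iota> ` carrier R"
  have A: "subring ?A K"
    by (rule \<iota>.ring.img_is_subring[OF R.carrier_is_subring])
  define J where "J k = {r \<in> carrier R. \<exists>y\<in>K.poly_span ?A \<gamma> k. \<iota> r = \<iota> \<alpha> \<otimes>\<^bsub>K\<^esub> y}" for k
  note span_carrier = subsetD[OF K.poly_span_carrier[OF subringE(1)[OF A] \<gamma>]]
  have J_ideal: "ideal (J k) R" for k
  proof (rule R.ideal_subsetI)
    show "\<zero>\<^bsub>R\<^esub> \<in> J k"
      using \<alpha> K.zero_in_poly_span[OF A \<gamma>] by (auto simp: J_def intro!: bexI[of _ "\<zero>\<^bsub>K\<^esub>"])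
    fix x assume "x \<in> J k"
    then obtain y where y: "x \<in> carrier R" "y \<in> K.poly_span ?A \<gamma> k" "\<iota> x = \<iota> \<alpha> \<otimes>\<^bsub>K\<^esub> y"
      by (auto simp: J_def)
    show "x \<oplus>\<^bsub>R\<^esub> x' \<in> J k" if x': "x' \<in> J k" for x'
    proof -
      obtain y' where y': "x' \<in> carrier R" "y' \<in> K.poly_span ?A \<gamma> k" "\<iota> x' = \<iota> \<alpha> \<otimes>\<^bsub>K\<^esub> y'"
        using x' by (auto simp: J_def)
      have "\<iota> (x \<oplus>\<^bsub>R\<^esub> x') = \<iota> \<alpha> \<otimes>\<^bsub>K\<^esub> (y \<oplus>\<^bsub>K\<^esub> y')"
        using \<alpha> y y' span_carrier by (simp add: K.r_distr)
      then show ?thesis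
        using K.poly_span_add[OF A \<gamma> y(2) y'(2)] y(1) y'(1) by (auto simp: J_def)
    qed
    show "x \<otimes>\<^bsub>R\<^esub> r \<in> J k" if "r \<in> carrier R" for r
    proof -
      have "\<iota> (x \<otimes>\<^bsub>R\<^esub> r) = \<iota> \<alpha> \<otimes>\<^bsub>K\<^esub> (\<iota> r \<otimes>\<^bsub>K\<^esub> y)"
        using \<alpha> y that span_carrier by (simp add: K.m_ac)
      then show ?thesis
        using K.poly_span_smult[OF A \<gamma> _ y(2), of "\<iota> r"] y(1) that by (auto simp: J_def)
    qed
  qed (auto simp: J_def)
  have J_Suc: "J k \<subseteq> J (Suc k)" for k
    using K.poly_span_mono_Suc[OF A \<gamma>] by (auto simp: J_def)
  obtain I where I: "I \<in> range J" "\<And>I'. I' \<in> range J \<Longrightarrow> I \<subseteq> I' \<Longrightarrow> I' = I"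
    using maximal_ideal_in_family[of "range J"] J_ideal by blast
  then obtain k where "I = J k"
    by blast
  then have stable: "J (Suc k) = J k"
    using I(2) J_Suc by simp
  obtain r where r: "r \<in> carrier R" "\<iota> \<alpha> \<otimes>\<^bsub>K\<^esub> \<gamma> [^]\<^bsub>K\<^esub> k = \<iota> r"
    using pow[of k] by auto
  then have "r \<in> J (Suc k)"
    using K.power_in_poly_span[OF A \<gamma>, of k] r(2)[symmetric] unfolding J_def by blast
  then obtain y where y: "y \<in> K.poly_span ?A \<gamma> k" "\<iota> \<alpha> \<otimes>\<^bsub>K\<^esub> \<gamma> [^]\<^bsub>K\<^esub> k = \<iota> \<alpha> \<otimes>\<^bsub>K\<^esub> y"
    unfolding stable r(2) by (auto simp: J_def)
  have "\<iota> \<alpha> \<noteq> \<zero>\<^bsub>K\<^esub>"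
    using \<alpha> inj_onD[OF embed_inj, of \<alpha> "\<zero>\<^bsub>R\<^esub>"] by auto
  then have "\<gamma> [^]\<^bsub>K\<^esub> k = y"
    using y \<alpha> \<gamma> span_carrier K.m_lcancel[of "\<iota> \<alpha>" "\<gamma> [^]\<^bsub>K\<^esub> k" y] by simp
  then have "\<gamma> [^]\<^bsub>K\<^esub> k \<in> K.poly_span ?A \<gamma> k"
    using y(1) by simp
  from K.power_dependent_imp_monic_root[OF A \<gamma> K.one_not_zero this] show ?thesis
    using integrally_closed \<gamma> unfolding integrally_closed_in_def by blast
qed

text \<open>
  Write \<open>\<pp> = (\<alpha> : \<beta>)\<close> and \<open>\<gamma> = \<beta> / \<alpha>\<close>, so that \<open>\<gamma> * \<pp>\<close> is contained in \<open>R\<close> while \<open>\<gamma>\<close> is not in \<open>R\<close>.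
  If \<open>\<gamma> * \<pp>\<close> were contained in \<open>\<pp>\<close>, then \<open>\<alpha> * \<gamma> ^ k\<close> would lie in \<open>R\<close> for all \<open>k\<close> and \<open>\<gamma>\<close>
  would be integral. Hence \<open>s = \<gamma> * \<pi>\<close> lies outside \<open>\<pp>\<close> for some \<open>\<pi>\<close> in \<open>\<pp>\<close>, and
  \<open>s * x = (\<gamma> * x) * \<pi>\<close> for every \<open>x\<close> in \<open>\<pp>\<close>.
\<close>

lemma uniformizer_exists:
  assumes p: "primeideal \<pp> R" and nz: "\<pp> \<noteq> {\<zero>\<^bsub>R\<^esub>}"
  obtains \<pi> s where "\<pi> \<in> \<pp>" "s \<in> carrier R" "s \<notin> \<pp>"
    "\<And>x. x \<in> \<pp> \<Longrightarrow> \<exists>r\<in>carrier R. s \<otimes>\<^bsub>R\<^esub> x = r \<otimes>\<^bsub>R\<^esub> \<pi>"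
proof -
  interpret p: primeideal \<pp> R
    by (rule p)
  obtain \<alpha> where \<alpha>: "\<alpha> \<in> \<pp>" "\<alpha> \<noteq> \<zero>\<^bsub>R\<^esub>"
    using nz p.zero_closed by blast
  then have \<alpha>R: "\<alpha> \<in> carrier R"
    using p.Icarr by blast
  obtain \<beta> where \<beta>: "\<beta> \<in> carrier R" "R.colon_ideal \<alpha> \<beta> = \<pp>"
    using prime_is_colon_ideal[OF p \<alpha> nonzero_prime_maximal] by blast
  have \<beta>_p: "\<exists>r\<in>carrier R. \<beta> \<otimes>\<^bsub>R\<^esub> x = \<alpha> \<otimes>\<^bsub>R\<^esub> r" if "x \<in> \<pp>" for x
    using that unfolding \<beta>(2)[symmetric] R.colon_ideal_def by blast
  have "\<exists>\<pi>\<in>\<pp>. \<exists>s\<in>carrier R - \<pp>. \<beta> \<otimes>\<^bsub>R\<^esub> \<pi> = \<alpha> \<otimes>\<^bsub>R\<^esub> s"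
  proof (rule ccontr)
    assume "\<not> ?thesis"
    then have stay: "\<exists>r\<in>\<pp>. \<beta> \<otimes>\<^bsub>R\<^esub> x = \<alpha> \<otimes>\<^bsub>R\<^esub> r" if "x \<in> \<pp>" for x
      using \<beta>_p that by blast
    have "\<iota> \<alpha> \<in> carrier K - {\<zero>\<^bsub>K\<^esub>}"
      using \<alpha>R \<alpha>(2) inj_onD[OF embed_inj, of \<alpha> "\<zero>\<^bsub>R\<^esub>"] by auto
    then have inv: "inv\<^bsub>K\<^esub> (\<iota> \<alpha>) \<in> carrier K" "\<iota> \<alpha> \<otimes>\<^bsub>K\<^esub> inv\<^bsub>K\<^esub> (\<iota> \<alpha>) = \<one>\<^bsub>K\<^esub>"
      using K.field_Units K.Units_inv_closed K.Units_r_inv by auto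
    define \<gamma> where "\<gamma> = \<iota> \<beta> \<otimes>\<^bsub>K\<^esub> inv\<^bsub>K\<^esub> (\<iota> \<alpha>)"
    have \<gamma>: "\<gamma> \<in> carrier K"
      using inv \<beta>(1) by (simp add: \<gamma>_def)
    have \<alpha>\<gamma>: "\<iota> \<alpha> \<otimes>\<^bsub>K\<^esub> \<gamma> = \<iota> \<beta>"
      using inv \<beta>(1) \<alpha>R by (simp add: \<gamma>_def K.m_lcomm[of "\<iota> \<alpha>"])
    have "\<exists>r\<in>\<pp>. \<iota> \<alpha> \<otimes>\<^bsub>K\<^esub> \<gamma> [^]\<^bsub>K\<^esub> k = \<iota> r" for k :: nat
    proof (induction k)
      case 0
      then show ?case
        using \<alpha>(1) \<alpha>R by auto
    next
      case (Suc k)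
      then obtain r where r: "r \<in> \<pp>" "\<iota> \<alpha> \<otimes>\<^bsub>K\<^esub> \<gamma> [^]\<^bsub>K\<^esub> k = \<iota> r"
        by blast
      obtain r' where r': "r' \<in> \<pp>" "\<beta> \<otimes>\<^bsub>R\<^esub> r = \<alpha> \<otimes>\<^bsub>R\<^esub> r'"
        using stay r(1) by blast
      have rR: "r \<in> carrier R" "r' \<in> carrier R"
        using r(1) r'(1) p.Icarr by auto
      have "\<iota> \<alpha> \<otimes>\<^bsub>K\<^esub> \<gamma> [^]\<^bsub>K\<^esub> Suc k = \<iota> r \<otimes>\<^bsub>K\<^esub> \<gamma>"
        unfolding r(2)[symmetric] using \<alpha>R \<gamma> by (simp add: K.m_assoc)
      also have "\<dots> = \<iota> (\<beta> \<otimes>\<^bsub>R\<^esub> r) \<otimes>\<^bsub>K\<^esub> inv\<^bsub>K\<^esub> (\<iota> \<alpha>)"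
        using \<beta>(1) rR inv by (simp add: \<gamma>_def K.m_ac)
      also have "\<dots> = \<iota> r' \<otimes>\<^bsub>K\<^esub> (\<iota> \<alpha> \<otimes>\<^bsub>K\<^esub> inv\<^bsub>K\<^esub> (\<iota> \<alpha>))"
        unfolding r'(2) using \<alpha>R rR inv(1) by (simp add: K.m_ac)
      also have "\<dots> = \<iota> r'"
        using inv(2) rR by simp
      finally show ?case
        using r'(1) by blast
    qed
    then have "\<gamma> \<in> \<iota> ` carrier R"
      using p.Icarr by (intro fractional_powers_imp_integral[OF \<gamma> \<alpha>R \<alpha>(2)]) blast
    then obtain g where g: "g \<in> carrier R" "\<gamma> = \<iota> g"
      by blast
    then have "\<iota> (\<beta> \<otimes>\<^bsub>R\<^esub> \<one>\<^bsub>R\<^esub>) = \<iota> (\<alpha> \<otimes>\<^bsub>R\<^esub> g)"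
      using \<alpha>\<gamma> \<alpha>R \<beta>(1) by simp
    from inj_onD[OF embed_inj this] have "\<beta> \<otimes>\<^bsub>R\<^esub> \<one>\<^bsub>R\<^esub> = \<alpha> \<otimes>\<^bsub>R\<^esub> g"
      using \<alpha>R \<beta>(1) g(1) by simp
    then have "\<one>\<^bsub>R\<^esub> \<in> \<pp>"
      unfolding \<beta>(2)[symmetric] R.colon_ideal_def using g(1) by blast
    then show False
      using p.one_imp_carrier p.I_notcarr by simp
  qed
  then obtain \<pi> s where \<pi>: "\<pi> \<in> \<pp>" "s \<in> carrier R" "s \<notin> \<pp>" "\<beta> \<otimes>\<^bsub>R\<^esub> \<pi> = \<alpha> \<otimes>\<^bsub>R\<^esub> s"
    by blast
  have "\<exists>r\<in>carrier R. s \<otimes>\<^bsub>R\<^esub> x = r \<otimes>\<^bsub>R\<^esub> \<pi>" if x: "x \<in> \<pp>" for x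
  proof -
    obtain r where r: "r \<in> carrier R" "\<beta> \<otimes>\<^bsub>R\<^esub> x = \<alpha> \<otimes>\<^bsub>R\<^esub> r"
      using \<beta>_p[OF x] by blast
    have cl: "x \<in> carrier R" "\<pi> \<in> carrier R"
      using x \<pi>(1) p.Icarr by auto
    have "\<alpha> \<otimes>\<^bsub>R\<^esub> (s \<otimes>\<^bsub>R\<^esub> x) = (\<alpha> \<otimes>\<^bsub>R\<^esub> s) \<otimes>\<^bsub>R\<^esub> x"
      using \<alpha>R \<pi>(2) cl by (simp add: R.m_assoc)
    also have "\<dots> = (\<beta> \<otimes>\<^bsub>R\<^esub> x) \<otimes>\<^bsub>R\<^esub> \<pi>"
      unfolding \<pi>(4)[symmetric] using \<beta>(1) cl by (simp add: R.m_ac)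
    also have "\<dots> = \<alpha> \<otimes>\<^bsub>R\<^esub> (r \<otimes>\<^bsub>R\<^esub> \<pi>)"
      unfolding r(2) using \<alpha>R r(1) cl by (simp add: R.m_assoc)
    finally have "s \<otimes>\<^bsub>R\<^esub> x = r \<otimes>\<^bsub>R\<^esub> \<pi>"
      using R.m_lcancel[OF \<alpha>(2) \<alpha>R] \<pi>(2) r(1) cl by simp
    then show ?thesis
      using r(1) by blast
  qed
  then show thesis
    using that \<pi>(1-3) by blast
qed

lemma residue_uniformizer_exists:
  assumes p: "primeideal \<pp> R" and nz: "\<pp> \<noteq> {\<zero>\<^bsub>R\<^esub>}"
  obtains \<pi> where "residue_uniformizer R K \<iota> (R Quot \<pp>) (\<lambda>r. \<pp> +>\<^bsub>R\<^esub> r) \<pi>"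
proof -
  interpret p: maximalideal \<pp> R
    by (rule nonzero_prime_maximal[OF p nz])
  interpret F: field "R Quot \<pp>"
    by (rule p.quotient_is_field[OF R.is_cring])
  let ?\<phi> = "\<lambda>r. \<pp> +>\<^bsub>R\<^esub> r"
  interpret \<phi>: ring_hom_cring R "R Quot \<pp>" ?\<phi>
    by (rule p.rcos_ring_hom_cring[OF R.is_cring])
  have surj: "?\<phi> ` carrier R = carrier (R Quot \<pp>)"
    unfolding FactRing_def A_RCOSETS_def' by auto
  have zero: "?\<phi> r = \<zero>\<^bsub>R Quot \<pp>\<^esub> \<longleftrightarrow> r \<in> \<pp>" if "r \<in> carrier R" for r
    using p.coset_eq_zero_iff[OF that] .
  obtain \<pi> s where \<pi>: "\<pi> \<in> \<pp>" and s: "s \<in> carrier R" "s \<notin> \<pp>"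
    and div: "\<And>x. x \<in> \<pp> \<Longrightarrow> \<exists>r\<in>carrier R. s \<otimes>\<^bsub>R\<^esub> x = r \<otimes>\<^bsub>R\<^esub> \<pi>"
    using uniformizer_exists[OF p nz] by metis
  have \<pi>R: "\<pi> \<in> carrier R"
    using \<pi> p.Icarr by blast
  have "residue_uniformizer R K \<iota> (R Quot \<pp>) ?\<phi> \<pi>"
  proof (intro residue_uniformizer.intro residue_uniformizer_axioms.intro)
    show "fraction_field R K \<iota>"
      by (rule fraction_field_axioms)
    show "field (R Quot \<pp>)"
      by (rule F.field_axioms)
    show "?\<phi> \<in> ring_hom R (R Quot \<pp>)"
      by (rule p.rcos_ring_hom)
    show "\<pi> \<noteq> \<zero>\<^bsub>R\<^esub>"
    proof
      assume "\<pi> = \<zero>\<^bsub>R\<^esub>"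
      obtain \<alpha> where \<alpha>: "\<alpha> \<in> \<pp>" "\<alpha> \<noteq> \<zero>\<^bsub>R\<^esub>"
        using nz p.zero_closed by blast
      then have "s \<otimes>\<^bsub>R\<^esub> \<alpha> = \<zero>\<^bsub>R\<^esub>"
        using div[OF \<alpha>(1)] \<open>\<pi> = \<zero>\<^bsub>R\<^esub>\<close> by auto
      then show False
        using \<alpha> s p.Icarr p.zero_closed R.integral[of s \<alpha>] by blast
    qed
    show "?\<phi> \<pi> = \<zero>\<^bsub>R Quot \<pp>\<^esub>"
      using zero \<pi> \<pi>R by simp
    fix x assume "x \<in> carrier R - {\<zero>\<^bsub>R\<^esub>}"
    then obtain t u k where t: "x \<in> carrier R" "t \<in> carrier R - \<pp>" "u \<in> carrier R - \<pp>"
      "t \<otimes>\<^bsub>R\<^esub> x = u \<otimes>\<^bsub>R\<^esub> \<pi> [^]\<^bsub>R\<^esub> (k::nat)"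
      using uniformizer_factorization[OF p \<pi> s div, of x] by auto
    then have "?\<phi> t \<in> Units (R Quot \<pp>)"
      using zero[of t] F.field_Units by simp
    then obtain y where y: "y \<in> carrier R" "?\<phi> y \<otimes>\<^bsub>R Quot \<pp>\<^esub> ?\<phi> t = \<one>\<^bsub>R Quot \<pp>\<^esub>"
      using surj F.Units_l_inv F.Units_inv_closed by (metis imageE)
    then have "?\<phi> y \<noteq> \<zero>\<^bsub>R Quot \<pp>\<^esub>"
      using t(2) by auto
    then have "?\<phi> (y \<otimes>\<^bsub>R\<^esub> u) \<noteq> \<zero>\<^bsub>R Quot \<pp>\<^esub>"
      using t(3) y(1) zero[of u] F.integral_iff by simp
    moreover have "?\<phi> (y \<otimes>\<^bsub>R\<^esub> t) = \<one>\<^bsub>R Quot \<pp>\<^esub>"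
      using t(2) y by simp
    moreover have "(y \<otimes>\<^bsub>R\<^esub> t) \<otimes>\<^bsub>R\<^esub> x = (y \<otimes>\<^bsub>R\<^esub> u) \<otimes>\<^bsub>R\<^esub> \<pi> [^]\<^bsub>R\<^esub> k"
      using t y(1) \<pi>R by (simp add: R.m_assoc)
    ultimately show "\<exists>t\<in>carrier R. \<exists>u\<in>carrier R. \<exists>k. ?\<phi> t = \<one>\<^bsub>R Quot \<pp>\<^esub> \<and> ?\<phi> u \<noteq> \<zero>\<^bsub>R Quot \<pp>\<^esub> \<and>
        t \<otimes>\<^bsub>R\<^esub> x = u \<otimes>\<^bsub>R\<^esub> \<pi> [^]\<^bsub>R\<^esub> (k::nat)"
      using t(2,3) y(1) by blast
  qed (use surj \<pi>R in auto)
  then show thesis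
    by (rule that)
qed

end

section \<open>The equation over the completion\<close>

theorem theorem15:
  fixes R :: "('a, 'm) ring_scheme" and K :: "('k, 'n) ring_scheme" and \<iota> :: "'a \<Rightarrow> 'k"
    and a b c :: 'a and n :: nat and \<pp> :: "'a set"
  defines "Kp \<equiv> adic_completion R K \<iota> \<pp>"
    and "j \<equiv> to_completion R K \<iota> \<pp>"
  assumes "dedekind_domain R K \<iota>"
    and "a \<in> carrier R - {\<zero>\<^bsub>R\<^esub>}" and "b \<in> carrier R - {\<zero>\<^bsub>R\<^esub>}" and "c \<in> carrier R - {\<zero>\<^bsub>R\<^esub>}"
    and "primeideal \<pp> R" and "\<pp> \<noteq> {\<zero>\<^bsub>R\<^esub>}"
    and "a \<notin> \<pp>" and "b \<notin> \<pp>" and "a \<oplus>\<^bsub>R\<^esub> b \<notin> \<pp>" and "c \<notin> \<pp>"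
    and "finite (a_rcosets\<^bsub>R\<^esub> \<pp>)"
    and "\<not> is_nth_power (R Quot \<pp>) n (residue_frac R \<pp> a c)"
    and "\<not> is_nth_power (R Quot \<pp>) n (residue_frac R \<pp> b c)"
    and "\<not> is_nth_power (R Quot \<pp>) n (residue_frac R \<pp> (a \<oplus>\<^bsub>R\<^esub> b) c)"
  shows "\<not> partition_regular_over (carrier Kp - {\<zero>\<^bsub>Kp\<^esub>})
           (\<lambda>w x y z. (j a \<otimes>\<^bsub>Kp\<^esub> x) \<oplus>\<^bsub>Kp\<^esub> (j b \<otimes>\<^bsub>Kp\<^esub> y)
                        = j c \<otimes>\<^bsub>Kp\<^esub> w \<otimes>\<^bsub>Kp\<^esub> (z [^]\<^bsub>Kp\<^esub> n))"
proof -
  interpret dedekind_domain R K \<iota>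
    by (rule assms(3))
  interpret p: primeideal \<pp> R
    by (rule assms(7))
  let ?F = "R Quot \<pp>"
  let ?\<phi> = "\<lambda>r. \<pp> +>\<^bsub>R\<^esub> r"
  obtain \<pi> where "residue_uniformizer R K \<iota> ?F ?\<phi> \<pi>"
    using residue_uniformizer_exists[OF assms(7,8)] .
  then interpret U: residue_uniformizer R K \<iota> ?F ?\<phi> \<pi> .
  have zero: "?\<phi> r = \<zero>\<^bsub>?F\<^esub> \<longleftrightarrow> r \<in> \<pp>" if "r \<in> carrier R" for r
    using p.coset_eq_zero_iff[OF that] .
  then have kernel: "a_kernel R ?F ?\<phi> = \<pp>"
    using p.Icarr by (auto simp: U.kernel_iff)
  have ac: "angular_component K ?F (adic_val R K \<iota> \<pp>) U.leading_coeff"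
    using U.leading_coeff_angular_component unfolding kernel .
  interpret A: adic_angular_component R K \<iota> \<pp> ?F U.leading_coeff
    by (intro adic_angular_component.intro ac)
  note carr = assms(4)[THEN DiffD1] assms(5)[THEN DiffD1] assms(6)[THEN DiffD1]
  have units: "?\<phi> a \<noteq> \<zero>\<^bsub>?F\<^esub>" "?\<phi> b \<noteq> \<zero>\<^bsub>?F\<^esub>" "?\<phi> c \<noteq> \<zero>\<^bsub>?F\<^esub>"
    using zero carr assms(9,10,12) by auto
  note lead = U.unit_leading_term(2)[OF carr(1) units(1)] U.unit_leading_term(2)[OF carr(2) units(2)]
    U.unit_leading_term(2)[OF carr(3) units(3)]
  note val = U.unit_leading_term(1)[OF carr(1) units(1), unfolded kernel]
    U.unit_leading_term(1)[OF carr(2) units(2), unfolded kernel]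
  have sum: "?\<phi> a \<oplus>\<^bsub>?F\<^esub> ?\<phi> b = ?\<phi> (a \<oplus>\<^bsub>R\<^esub> b)"
    using carr by simp
  have no_power: "?\<phi> c \<otimes>\<^bsub>?F\<^esub> t [^]\<^bsub>?F\<^esub> n \<noteq> ?\<phi> r"
    if "\<not> is_nth_power ?F n (residue_frac R \<pp> r c)" "t \<in> carrier ?F" for t r
  proof
    assume eq: "?\<phi> c \<otimes>\<^bsub>?F\<^esub> t [^]\<^bsub>?F\<^esub> n = ?\<phi> r"
    have "?\<phi> c \<in> Units ?F"
      using units(3) carr(3) U.F.field_Units by simp
    then have c': "inv\<^bsub>?F\<^esub> ?\<phi> c \<in> carrier ?F" "?\<phi> c \<otimes>\<^bsub>?F\<^esub> inv\<^bsub>?F\<^esub> ?\<phi> c = \<one>\<^bsub>?F\<^esub>"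
      by auto
    have "residue_frac R \<pp> r c = t [^]\<^bsub>?F\<^esub> n \<otimes>\<^bsub>?F\<^esub> (?\<phi> c \<otimes>\<^bsub>?F\<^esub> inv\<^bsub>?F\<^esub> ?\<phi> c)"
      unfolding residue_frac_def eq[symmetric] using c'(1) that(2) carr(3) by (simp add: U.F.m_ac)
    also have "\<dots> = t [^]\<^bsub>?F\<^esub> n"
      using c'(2) that(2) by simp
    finally show False
      using that unfolding is_nth_power_def by blast
  qed
  show ?thesis
    unfolding Kp_def j_def
  proof (rule A.completion_not_partition_regular[OF carr])
    show "\<iota> a \<in> carrier K - {\<zero>\<^bsub>K\<^esub>}" "\<iota> b \<in> carrier K - {\<zero>\<^bsub>K\<^esub>}" "\<iota> c \<in> carrier K - {\<zero>\<^bsub>K\<^esub>}"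
      by (rule U.embed_nonzero, rule assms)+
    show "finite (carrier ?F)"
      unfolding FactRing_def partial_object.select_convs by (rule assms(13))
    show "adic_val R K \<iota> \<pp> (\<iota> a) = adic_val R K \<iota> \<pp> (\<iota> b)"
      by (simp add: val)
    show "U.leading_coeff (\<iota> a) \<oplus>\<^bsub>?F\<^esub> U.leading_coeff (\<iota> b) \<noteq> \<zero>\<^bsub>?F\<^esub>"
      unfolding lead sum using zero[OF R.a_closed[OF carr(1,2)]] assms(11) by blast
    show "U.leading_coeff (\<iota> c) \<otimes>\<^bsub>?F\<^esub> t [^]\<^bsub>?F\<^esub> n \<notin> {U.leading_coeff (\<iota> a), U.leading_coeff (\<iota> b),
        U.leading_coeff (\<iota> a) \<oplus>\<^bsub>?F\<^esub> U.leading_coeff (\<iota> b)}" if "t \<in> carrier ?F" for t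
      unfolding lead sum using no_power assms(14-16) that by blast
  qed
qed

end
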